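(* For every integer $n\geq 27$, the language $T_n$ of threshold words of order $n$ (that is, the set of all finite $\mathrm{RT}(n)^+$-free words over an $n$-letter alphabet, where $\mathrm{RT}(n)=n/(n-1)$) grows exponentially.
   Context: For a positive integer $n$, $A_n=\{\mathtt{1},\mathtt{2},\dots,\mathtt{n}\}$ denotes an $n$-letter alphabet. A positive integer $p$ is a period of a finite word $w=w_1w_2\cdots w_k$ (the $w_i$ being letters) if $w_{i+p}=w_i$ for all $1\leq i\leq k-p$. In this case $|w|/p$ is an exponent of $w$, and the largest such number is called the exponent of $w$. For a real number $r>1$, a finite or infinite word is $r^+$-free if none of its finite factors (contiguous subwords) has exponent strictly greater than $r$. For $n\geq 2$, the repetition threshold is $\mathrm{RT}(n)=\inf\{r>1 : \text{there is an infinite } r^+\text{-free word over } A_n\}$. By Dejean's theorem (known), $\mathrm{RT}(n)=n/(n-1)$ for every $n\geq 5$. The threshold language $T_n$ of order $n$ is the set of all finite $\mathrm{RT}(n)^+$-free words over $A_n$; its members are called threshold words of order $n$. The combinatorial complexity of a language $L$ is the function $C_L:\mathbb{N}\to\mathbb{N}$ where $C_L(k)$ is the number of words in $L$ of length $k$. A language $L$ grows exponentially if the sequence $C_L(k)$ grows exponentially in $k$, i.e. its growth rate $\limsup_{k\to\infty}(C_L(k))^{1/k}$ is greater than $1$. If $L$ is closed under taking factors, as $T_n$ is, the $\limsup$ is a limit, so this is equivalent to the existence of a constant $c>1$ with $C_L(k)\geq c^k$ for all sufficiently large $k$. *)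

theory Defs
  imports Complex_Main "HOL-Library.Sublist" "HOL-Library.Extended_Real" "HOL-Library.Liminf_Limsup"
begin

text \<open>Finite words are lists, infinite words are functions on \<^typ>\<open>nat\<close>; positions are counted from 0.\<close>

definition alphabet :: "nat \<Rightarrow> nat set" where
  "alphabet n = {1..n}"

definition is_period :: "'a list \<Rightarrow> nat \<Rightarrow> bool" where
  "is_period w p \<longleftrightarrow> 0 < p \<and> (\<forall>i. i + p < length w \<longrightarrow> w ! (i + p) = w ! i)"

definition is_exponent :: "'a list \<Rightarrow> real \<Rightarrow> bool" where
  "is_exponent w e \<longleftrightarrow> (\<exists>p. is_period w p \<and> e = real (length w) / real p)"

definition exponent :: "'a list \<Rightarrow> real" where
  "exponent w = (GREATEST e. is_exponent w e)"

text \<open>The maximum in the definition of \<^const>\<open>exponent\<close> always exists, since there is a least period.\<close>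

lemma exponent_is_greatest:
  shows "is_exponent w (exponent w)" and "is_exponent w e \<Longrightarrow> e \<le> exponent w"
proof -
  define p where "p = (LEAST p. is_period w p)"
  have "is_period w (Suc (length w))"
    by (simp add: is_period_def)
  then have p: "is_period w p"
    unfolding p_def by (rule LeastI)
  have le: "p \<le> q" if "is_period w q" for q
    unfolding p_def using that by (rule Least_le)
  have pos: "0 < p"
    using p by (simp add: is_period_def)
  have exp: "is_exponent w (real (length w) / real p)"
    using p unfolding is_exponent_def by blast
  have bound: "d \<le> real (length w) / real p" if "is_exponent w d" for d
    using that le pos unfolding is_exponent_def by (auto intro!: divide_left_mono simp: is_period_def)
  have "exponent w = real (length w) / real p"
    unfolding exponent_def using exp bound by (rule Greatest_equality)
  then show "is_exponent w (exponent w)" and "is_exponent w e \<Longrightarrow> e \<le> exponent w"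
    using exp bound by simp_all
qed

definition plus_free :: "real \<Rightarrow> 'a list \<Rightarrow> bool" where
  "plus_free r w \<longleftrightarrow> (\<forall>u. sublist u w \<longrightarrow> exponent u \<le> r)"

definition plus_free_inf :: "real \<Rightarrow> (nat \<Rightarrow> 'a) \<Rightarrow> bool" where
  "plus_free_inf r x \<longleftrightarrow> (\<forall>i j. exponent (map x [i..<j]) \<le> r)"

text \<open>Meaningful for \<open>n \<ge> 2\<close> only: for smaller \<open>n\<close> the set is empty and the infimum on
  \<^typ>\<open>real\<close> is a junk value.\<close>

definition RT :: "nat \<Rightarrow> real" where
  "RT n = Inf {r. 1 < r \<and> (\<exists>x :: nat \<Rightarrow> nat. range x \<subseteq> alphabet n \<and> plus_free_inf r x)}"

definition threshold_language :: "nat \<Rightarrow> nat list set" where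
  "threshold_language n = {w. set w \<subseteq> alphabet n \<and> plus_free (RT n) w}"

definition complexity :: "'a list set \<Rightarrow> nat \<Rightarrow> nat" where
  "complexity L k = card {w \<in> L. length w = k}"

definition growth_rate :: "'a list set \<Rightarrow> ereal" where
  "growth_rate L = limsup (\<lambda>k. ereal (root k (real (complexity L k))))"

definition grows_exponentially :: "'a list set \<Rightarrow> bool" where
  "grows_exponentially L \<longleftrightarrow> growth_rate L > 1"

end

(*
Infinitely many n/(n-1)^+-free words are written down explicitly. Put N = n - 1 and write positions
as rows of length N. Each odd column of the base word carries its own fixed letter; the even columns
are filled cyclically by l + 1 moving letters, where l is the number of even columns. The base word
has period B = N(l + 1), and its letters recur at distance N (fixed) or about N + 2 (moving), so
repetitions of period below B are harmless.

The long periods are destroyed by perturbing the base word: letters are grouped into disjoint sites of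
two adjacent fixed and two adjacent moving letters. In every period there is one place where the four
letters of a site occur consecutively, and there they may be permuted cyclically from then on without
creating a short repetition. A run of period p >= B contains a fixed and a moving letter that
belong to no site, so B divides p. If p = qB, each site that the run sees must have rotated 0 mod 4 times in q base periods. The rotation schedules of
successive sites force 4 | q, 16 | q, ..., 4^J | q, and the schedule of the last site, a digit of the
odd part of the counter, differs at some two counter values at distance q inside the run. One site
has a schedule with free bits, which gives exponentially many words.
*)

theory Submission
  imports Defs
begin

section \<open>Odd parts, cancellation modulo 4 and sums of periodic sequences\<close>

datatype letter = Fixed nat | Moving nat

fun oddpart :: "nat \<Rightarrow> nat" where
  "oddpart k = (if even k \<and> 0 < k then oddpart (k div 2) else k)"

declare oddpart.simps [simp del]

lemma oddpart_eq: "odd c \<Longrightarrow> oddpart (2 ^ a * c) = c"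
proof (induction a)
  case 0
  then show ?case by (simp add: oddpart.simps)
next
  case (Suc a)
  have "0 < c"
    using Suc.prems by (auto intro: Nat.gr0I)
  then have "oddpart (2 ^ Suc a * c) = oddpart (2 ^ a * c)"
    by (subst oddpart.simps) simp
  with Suc show ?case by simp
qed

text \<open>Write \<open>s = 2 ^ a * b\<close> with \<open>b\<close> odd. A window of
  \<open>2 * s\<close> integers contains some \<open>2 ^ a * c\<close> with \<open>c\<close> odd;
  adding \<open>4 ^ e * s\<close> turns its odd part \<open>c\<close> into
  \<open>c + 4 ^ e * b\<close>, so the quotient by \<open>4 ^ e\<close> grows by the odd number
  \<open>b\<close>.\<close>

lemma oddpart_shift_parity:
  assumes "1 \<le> e" "0 < s"
  shows "\<exists>j\<in>{k + 1..k + 2 * s}. oddpart (j + 4 ^ e * s) div 4 ^ e mod 2 \<noteq> oddpart j div 4 ^ e mod (2::nat)"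
proof -
  have "\<exists>a b. s = 2 ^ a * b \<and> odd b" using assms(2)
  proof (induction s rule: less_induct)
    case (less s)
    show ?case
    proof (cases "even s")
      case True
      then obtain t where t: "s = 2 * t" by blast
      then have "t < s" "0 < t" using less.prems by simp_all
      then obtain a b where "t = 2 ^ a * b" "odd b" using less.IH by blast
      then show ?thesis using t by (intro exI[of _ "Suc a"] exI[of _ b]) simp
    next
      case False
      then show ?thesis by (intro exI[of _ 0] exI[of _ s]) simp
    qed
  qed
  then obtain a b where s: "s = 2 ^ a * b" "odd b" by blast
  define D where "D = (2::nat) ^ Suc a"
  \<comment> \<open>\<open>j\<close> becomes the unique integer from \<open>k + 1\<close> to
    \<open>k + D\<close> that is congruent to \<open>2 ^ a\<close> modulo \<open>D\<close>, and
    \<open>D \<le> 2 * s\<close>.\<close>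
  define c where "c = 2 * ((k + 2 ^ a) div D) + 1"
  define j where "j = 2 ^ a * c"
  have j: "j = D * ((k + 2 ^ a) div D) + 2 ^ a" unfolding j_def c_def D_def by (simp add: algebra_simps)
  have D: "D = 2 * 2 ^ a" "0 < D" unfolding D_def by simp_all
  have "D * ((k + 2 ^ a) div D) \<le> k + 2 ^ a" "k + 2 ^ a < D * ((k + 2 ^ a) div D) + D"
    using dividend_less_times_div[OF D(2), of "k + 2 ^ a"] by (simp_all add: add.commute)
  then have jb: "k < j" "j \<le> k + D" using D(1) unfolding j by linarith+
  have "1 \<le> b" using s(2) by (cases b) simp_all
  then have "2 ^ a * 1 \<le> s" unfolding s(1) by (rule mult_le_mono2)
  then have jin: "j \<in> {k + 1..k + 2 * s}" using jb D(1) by simp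
  have "odd c" unfolding c_def by simp
  then have o1: "oddpart j = c" unfolding j_def by (rule oddpart_eq)
  have "odd (c + 4 ^ e * b)" using \<open>odd c\<close> assms(1) by simp
  then have "oddpart (2 ^ a * (c + 4 ^ e * b)) = c + 4 ^ e * b" by (rule oddpart_eq)
  moreover have "j + 4 ^ e * s = 2 ^ a * (c + 4 ^ e * b)" unfolding j_def s(1) by (simp add: algebra_simps)
  ultimately have "oddpart (j + 4 ^ e * s) div 4 ^ e = b + oddpart j div 4 ^ e" using o1 by simp
  then have "oddpart (j + 4 ^ e * s) div 4 ^ e mod 2 \<noteq> oddpart j div 4 ^ e mod 2"
    using s(2) by (simp add: mod2_eq_if)
  then show ?thesis using jin by blast
qed

lemma add_mod4_cancel: "(a + x) mod 4 = (b + x) mod (4::nat) \<Longrightarrow> a mod 4 = b mod 4"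
proof -
  assume eq: "(a + x) mod 4 = (b + x) mod 4"
  \<comment> \<open>Adding \<open>3 * x\<close> undoes adding \<open>x\<close> modulo 4.\<close>
  have *: "c mod 4 = ((c + x) mod 4 + 3 * x) mod 4" for c
    by (simp add: mod_add_left_eq)
  show "a mod 4 = b mod 4"
    by (subst (1 2) *) (simp only: eq)
qed

lemma sum_periodic:
  fixes f :: "nat \<Rightarrow> nat"
  assumes per: "\<And>j. f (j + d) = f j"
  shows "(\<Sum>j\<in>{k + 1..k + d * s}. f j) = s * (\<Sum>j\<in>{1..d}. f j)"
proof -
  have block: "(\<Sum>j\<in>{k + 1..k + d}. f j) = (\<Sum>j\<in>{1..d}. f j)" for k
  proof (induction k)
    case (Suc k)
    have "f (Suc k) + (\<Sum>j\<in>{Suc k + 1..Suc k + d}. f j) = (\<Sum>j\<in>{Suc k..Suc k + d}. f j)"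
      by (subst sum.atLeast_Suc_atMost[of "Suc k"]) simp_all
    also have "\<dots> = (\<Sum>j\<in>{k + 1..k + d}. f j) + f (Suc k + d)"
      by simp
    finally show ?case using per[of "Suc k"] Suc by simp
  qed simp
  show ?thesis
  proof (induction s)
    case (Suc s)
    have "(\<Sum>j\<in>{k + 1..k + d * Suc s}. f j)
        = (\<Sum>j\<in>{k + 1..k + d * s}. f j) + (\<Sum>j\<in>{(k + d * s) + 1..(k + d * s) + d}. f j)"
      using sum.ub_add_nat[of "k + 1" "k + d * s" f d] by (simp add: add.commute add.left_commute)
    then show ?case using Suc block by simp
  qed simp
qed

lemma sum_of_bool_dvd:
  fixes d :: nat
  assumes "0 < d"
  shows "(\<Sum>j\<in>{1..d}. of_bool (d dvd j)) = (1::nat)"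
proof -
  have "j = d" if "d dvd j" "1 \<le> j" "j \<le> d" for j using dvd_imp_le[OF that(1)] that by simp
  then have "{1..d} \<inter> {j. d dvd j} = {d}" using assms by fastforce
  then show ?thesis by (simp add: of_bool_def sum.If_cases)
qed

section \<open>Parameters and the placement of the sites\<close>

locale dejean_word =
  fixes n :: nat and bit :: "nat \<Rightarrow> bool"
  assumes n_ge: "27 \<le> n"
begin

definition N :: nat where "N = n - 1"
text \<open>\<open>l\<close> and \<open>phi\<close> are the numbers of even and odd columns in a
  row; \<open>phi\<close> fixed and \<open>l + 1\<close> moving letters make up the
  alphabet.\<close>

definition l :: nat where "l = n div 2"
definition phi :: nat where "phi = N div 2"
definition B :: nat where "B = N * (l + 1)"
definition J :: nat where "J = l div 4"
definition m :: nat where "m = (l + 1) div 4 + l div 4"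

lemma n_eq: "n = N + 1"
  using n_ge by (simp add: N_def)

lemma div_mod_eqI: "c < N \<Longrightarrow> j = r * N + c \<Longrightarrow> j div N = r" "c < N \<Longrightarrow> j = r * N + c \<Longrightarrow> j mod N = c"
  by simp_all

lemma N_cases: "N = 2 * l \<and> phi = l \<and> 13 \<le> l \<or> N + 1 = 2 * l \<and> phi + 1 = l \<and> 14 \<le> l"
  using n_ge unfolding N_def l_def phi_def by presburger

lemma J_bounds: "4 * J \<le> l" "l \<le> 4 * J + 3" "3 \<le> J"
  using N_cases unfolding J_def by auto

lemma m_cases: "m = 2 * J \<and> l \<le> 4 * J + 2 \<or> m = 2 * J + 1 \<and> l = 4 * J + 3"
  unfolding m_def J_def by presburger

lemma params: "13 \<le> l" "26 \<le> N" "N \<le> 2 * l" "2 * l \<le> N + 1" "phi \<le> l" "l \<le> phi + 1"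
    "2 * phi \<le> N" "N \<le> 2 * phi + 1" "m + 7 \<le> phi" "2 * J + 7 \<le> l" "2 * J \<le> m" "n = phi + l + 1"
proof -
  have "J = 3 \<or> 4 \<le> J" using J_bounds by auto
  with N_cases J_bounds m_cases n_eq
  show "13 \<le> l" "26 \<le> N" "N \<le> 2 * l" "2 * l \<le> N + 1" "phi \<le> l" "l \<le> phi + 1"
    "2 * phi \<le> N" "N \<le> 2 * phi + 1" "m + 7 \<le> phi" "2 * J + 7 \<le> l" "2 * J \<le> m" "n = phi + l + 1"
    by auto
qed

lemma N_pos: "0 < N" using params by simp
lemma B_pos: "0 < B" using N_pos by (simp add: B_def)
lemma N2_le_B: "2 * N \<le> B"
  using params by (simp add: B_def)

text \<open>Site \<open>i < J + 2\<close> consists of the fixed letters \<open>fx i\<close>, \<open>fx i + 1\<close> and the moving letters \<open>mv i\<close>,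
  \<open>mv i + 1\<close>. Site 0 defeats the periods \<open>q * B\<close> with \<open>4 ^ J\<close> dividing \<open>q\<close>, site 1 carries the free bits.
  Since \<open>m\<close> is about \<open>l / 2\<close>, any \<open>l + 2\<close> consecutive positions meet site 3 or both of the sites 1 and 2,
  which is what the period \<open>B\<close> requires.\<close>

definition fx :: "nat \<Rightarrow> nat" where
  "fx i = (if i < 3 then m + 4 - 2 * i else 2 * i - 5)"

definition mv :: "nat \<Rightarrow> nat" where
  "mv i = (if i < 3 then 2 * i + 1 else 2 * J + 10 - 2 * i)"

lemma fx_range: "i < J + 2 \<Longrightarrow> 1 \<le> fx i \<and> fx i + 3 \<le> phi"
  using params(9,11) J_bounds unfolding fx_def by auto

text \<open>Keeps the fixed letters \<open>2 * J - 1\<close> and \<open>m + 6\<close> out of all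
  sites; with the letter 0 they are the markers of \<open>untouched_Fixed_in_window\<close>.\<close>

lemma fx_avoids: "i < J + 2 \<Longrightarrow> fx i \<noteq> 2 * J - 1 \<and> fx i + 1 \<noteq> 2 * J - 1 \<and> fx i + 1 < m + 6"
  using params(11) J_bounds(3) unfolding fx_def by (auto split: if_splits)

lemma mv_range: "i < J + 2 \<Longrightarrow> 1 \<le> mv i \<and> mv i + 2 \<le> l"
  using params(1,10) unfolding mv_def by (auto split: if_splits)

lemma mv_avoids: "i < J + 2 \<Longrightarrow> mv i \<noteq> 7 \<and> mv i + 1 \<noteq> 7 \<and> mv i + 1 < 2 * J + 6"
  using J_bounds(3) unfolding mv_def by (simp split: if_splits; presburger)

lemma fx_inj: "\<lbrakk>i < J + 2; j < J + 2; fx i = fx j\<rbrakk> \<Longrightarrow> i = j"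
  using params(11) J_bounds(3) unfolding fx_def by (simp split: if_splits)

lemma fx_sep: "\<lbrakk>i < J + 2; j < J + 2\<rbrakk> \<Longrightarrow> fx i \<noteq> fx j + 1"
  using params(11) J_bounds(3) unfolding fx_def by (cases "i < 3"; cases "j < 3"; simp; presburger)

lemma mv_inj: "\<lbrakk>i < J + 2; j < J + 2; mv i = mv j\<rbrakk> \<Longrightarrow> i = j"
  using J_bounds(3) unfolding mv_def by (simp split: if_splits)

lemma mv_sep: "\<lbrakk>i < J + 2; j < J + 2\<rbrakk> \<Longrightarrow> mv i \<noteq> mv j + 1"
  using J_bounds(3) unfolding mv_def by (cases "i < 3"; cases "j < 3"; simp; presburger)

text \<open>Inside each of the groups \<open>i < 3\<close> and \<open>3 \<le> i\<close> one of
  \<open>fx\<close>, \<open>mv\<close> increases while the other decreases, and across the groups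
  the premise never holds. This prevents the block of one site from continuing directly into the
  block of another.\<close>

lemma fx_mv_cross: "\<lbrakk>i < J + 2; j < J + 2; fx j = fx i + 2\<rbrakk> \<Longrightarrow> mv j \<noteq> mv i + 2"
  using params(11) J_bounds(3) unfolding fx_def mv_def by (cases "i < 3"; cases "j < 3"; simp; presburger)

section \<open>The base word and its perturbation\<close>

text \<open>For an even column, \<open>j div N * l + j mod N div 2\<close> counts the even-column
  cells before \<open>j\<close>. As \<open>l\<close> is -1 modulo \<open>l + 1\<close>, going down
  one row in a column lowers the index by 1, so a moving letter normally reappears one row down and
  two columns to the right.\<close>

definition bas :: "nat \<Rightarrow> letter" where
  "bas j = (if odd (j mod N) then Fixed (j mod N div 2)
            else Moving ((j div N * l + j mod N div 2) mod (l + 1)))"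

text \<open>The slots of a site are numbered along the rotation, not in their order 0, 1, 3, 2 within a row.
  With this numbering every slot receives a letter last seen at distance \<open>N\<close>, \<open>N + 1\<close> or \<open>N + 2\<close>, and slots
  next to each other in a row receive letters with different distances.\<close>

definition sl :: "nat \<Rightarrow> nat \<Rightarrow> letter" where
  "sl i d = (if d = 0 then Fixed (fx i) else if d = 1 then Moving (mv i)
             else if d = 2 then Moving (mv i + 1) else Fixed (fx i + 1))"

lemma sl_simps [simp]:
  "sl i 0 = Fixed (fx i)" "sl i (Suc 0) = Moving (mv i)" "sl i 2 = Moving (mv i + 1)"
  "sl i 3 = Fixed (fx i + 1)"
  by (simp_all add: sl_def)

definition touched :: "letter \<Rightarrow> bool" where
  "touched b \<longleftrightarrow> (\<exists>i<J + 2. \<exists>d<4. b = sl i d)"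

lemma less4: "(d::nat) < 4 \<longleftrightarrow> d = 0 \<or> d = Suc 0 \<or> d = 2 \<or> d = 3"
  by auto

lemma touched_Fixed: "touched (Fixed f) \<longleftrightarrow> (\<exists>i<J + 2. f = fx i \<or> f = fx i + 1)"
proof
  assume "\<exists>i<J + 2. f = fx i \<or> f = fx i + 1"
  then obtain i where "i < J + 2" "Fixed f = sl i 0 \<or> Fixed f = sl i 3" by auto
  moreover have "(0::nat) < 4" "(3::nat) < 4" by simp_all
  ultimately show "touched (Fixed f)" unfolding touched_def by metis
qed (auto simp: touched_def less4)

lemma touched_Moving: "touched (Moving u) \<longleftrightarrow> (\<exists>i<J + 2. u = mv i \<or> u = mv i + 1)"
proof
  assume "\<exists>i<J + 2. u = mv i \<or> u = mv i + 1"
  then obtain i where "i < J + 2" "Moving u = sl i 1 \<or> Moving u = sl i 2" by auto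
  moreover have "(1::nat) < 4" "(2::nat) < 4" by simp_all
  ultimately show "touched (Moving u)" unfolding touched_def by metis
qed (auto simp: touched_def less4)

lemma sl_inj:
  assumes "i < J + 2" "j < J + 2" "d < 4" "d' < 4" "sl i d = sl j d'"
  shows "i = j \<and> d = d'"
proof -
  have "i = j"
    using assms fx_inj[of i j] mv_inj[of i j] fx_sep[of i j] fx_sep[of j i] mv_sep[of i j] mv_sep[of j i]
    unfolding less4 by auto
  moreover from this have "d = d'"
    using assms unfolding less4 by auto
  ultimately show ?thesis ..
qed

text \<open>In row \<open>r\<close> of length \<open>N\<close>, site \<open>i\<close> occurs as the block \<open>Fixed (fx i)\<close>, \<open>Moving (mv i)\<close>,
  \<open>Fixed (fx i + 1)\<close>, \<open>Moving (mv i + 1)\<close> exactly when \<open>r\<close> is congruent to \<open>fx i + 1 - mv i\<close> modulo \<open>l + 1\<close>.\<close>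

definition ev :: "nat \<Rightarrow> nat" where
  "ev i = ((fx i + (l + 2) - mv i) mod (l + 1)) * N + (2 * fx i + 1)"

text \<open>\<open>K i j\<close> counts the places of site \<open>i\<close> up to position \<open>j\<close>, and \<open>eps i k\<close> tells whether the site rotates at
  the \<open>k\<close>-th one (counted from 1); the word has rotated the site \<open>X i (K i j)\<close> times by position \<open>j\<close>.\<close>

definition K :: "nat \<Rightarrow> nat \<Rightarrow> nat" where
  "K i j = (j + B - ev i) div B"

definition eps :: "nat \<Rightarrow> nat \<Rightarrow> nat" where
  "eps i k =
    (if i = 0 then (oddpart k div 4 ^ J) mod 2
     else if i = 1 then (if k mod 4 = 1 then of_bool (bit (k div 4)) else 1)
     else if i = 2 then (if k mod 4 = 3 then 0 else 1)
     else if i = 3 then 1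
     else of_bool (4 ^ (i - 2) dvd k))"

definition X :: "nat \<Rightarrow> nat \<Rightarrow> nat" where
  "X i k = (\<Sum>j\<in>{1..k}. eps i j)"

text \<open>\<open>inv_into\<close> reads off site and slot of a touched base letter, unambiguously
  by \<open>sl_inj\<close>; \<open>w_site\<close> is the form used later.\<close>

definition w :: "nat \<Rightarrow> letter" where
  "w j = (if touched (bas j) then
      (let (i, d) = inv_into ({..<J + 2} \<times> {..<4}) (\<lambda>(i, d). sl i d) (bas j)
       in sl i ((d + X i (K i j)) mod 4)) else bas j)"

lemma w_untouched: "\<not> touched (bas j) \<Longrightarrow> w j = bas j"
  by (simp add: w_def)

lemma w_site:
  assumes "i < J + 2" "d < 4" "bas j = sl i d"
  shows "w j = sl i ((d + X i (K i j)) mod 4)"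
proof -
  have inj: "inj_on (\<lambda>(i, d). sl i d) ({..<J + 2} \<times> {..<4})"
    by (rule inj_onI) (use sl_inj in auto)
  have "inv_into ({..<J + 2} \<times> {..<4}) (\<lambda>(i, d). sl i d) (case (i, d) of (i, d) \<Rightarrow> sl i d) = (i, d)"
    by (rule inv_into_f_f[OF inj]) (use assms in simp)
  then have "inv_into ({..<J + 2} \<times> {..<4}) (\<lambda>(i, d). sl i d) (bas j) = (i, d)"
    using assms by simp
  moreover have "touched (bas j)"
    unfolding touched_def using assms by blast
  ultimately show ?thesis
    by (simp add: w_def)
qed

lemma touched_w: "touched (w j) \<longleftrightarrow> touched (bas j)"
proof (cases "touched (bas j)")
  case True
  then obtain i d where i: "i < J + 2" "d < 4" "bas j = sl i d"
    unfolding touched_def by blast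
  have "(d + X i (K i j)) mod 4 < 4" by simp
  then show ?thesis
    using w_site[OF i] i(1) True unfolding touched_def by metis
qed (simp add: w_untouched)

text \<open>A rotation permutes the letters of one site among themselves, so a letter of the word
  still reveals whether its base letter is touched, and by which site.\<close>

lemma w_eq_cases:
  assumes "w x = w y"
  obtains (untouched) "\<not> touched (bas x)" "\<not> touched (bas y)" "bas y = bas x"
  | (site) i d d' where "i < J + 2" "d < 4" "d' < 4" "bas x = sl i d" "bas y = sl i d'"
      "(d + X i (K i x)) mod 4 = (d' + X i (K i y)) mod 4"
proof (cases "touched (bas x)")
  case False
  then have "\<not> touched (bas y)"
    using assms touched_w by metis
  then show thesis
    using untouched False assms w_untouched by metis
next
  case True
  then have "touched (bas y)"
    using assms touched_w by metis
  with True obtain i d i' d' where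
    i: "i < J + 2" "d < 4" "bas x = sl i d" and i': "i' < J + 2" "d' < 4" "bas y = sl i' d'"
    unfolding touched_def by blast
  have "sl i ((d + X i (K i x)) mod 4) = sl i' ((d' + X i' (K i' y)) mod 4)"
    using assms w_site[OF i] w_site[OF i'] by simp
  then have "i = i' \<and> (d + X i (K i x)) mod 4 = (d' + X i' (K i' y)) mod 4"
    by (intro sl_inj) (use i i' in simp_all)
  then show thesis
    using site i i' by blast
qed

lemma bas_eq_Fixed: "bas j = Fixed f \<longleftrightarrow> j mod N = 2 * f + 1"
  unfolding bas_def by (auto elim: oddE)

lemma bas_eq_Moving:
  "bas j = Moving u \<longleftrightarrow> even (j mod N) \<and> (j div N * l + j mod N div 2) mod (l + 1) = u"
  unfolding bas_def by auto

section \<open>Counters of places and rotations\<close>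

lemma X_Suc: "X i (Suc k) = X i k + eps i (Suc k)"
  by (simp add: X_def)

lemma X_add: "X i (k + q) = X i k + (\<Sum>j\<in>{k + 1..k + q}. eps i j)"
  by (induction q) (simp_all add: X_Suc)

lemma eps_le: "eps i k \<le> 1"
proof -
  have "oddpart k div 4 ^ J mod 2 \<le> 1"
    by (metis One_nat_def Suc_1 less_Suc_eq_le mod_less_divisor zero_less_Suc)
  then show ?thesis by (simp add: eps_def)
qed

lemma ev_less: "i < J + 2 \<Longrightarrow> ev i < B"
proof -
  assume i: "i < J + 2"
  have "ev i < ((fx i + (l + 2) - mv i) mod (l + 1)) * N + N"
    unfolding ev_def using fx_range[OF i] params by simp
  also have "\<dots> = Suc ((fx i + (l + 2) - mv i) mod (l + 1)) * N" by simp
  also have "\<dots> \<le> (l + 1) * N"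
    by (rule mult_right_mono) (simp_all add: Suc_leI)
  finally show ?thesis by (simp add: B_def mult.commute)
qed

lemma K_mono: "x \<le> y \<Longrightarrow> K i x \<le> K i y"
  unfolding K_def by (intro div_le_mono) simp

lemma K_add_B: "i < J + 2 \<Longrightarrow> K i (x + q * B) = K i x + q"
proof -
  assume "i < J + 2"
  then have "x + q * B + B - ev i = (x + B - ev i) + q * B"
    using ev_less[of i] by simp
  then show ?thesis
    unfolding K_def using B_pos by simp
qed

lemma K_step: "i < J + 2 \<Longrightarrow> y \<le> x + B \<Longrightarrow> K i y \<le> K i x + 1"
  using K_mono[of y "x + 1 * B" i] K_add_B[of i x 1] by simp

lemma K_event:
  assumes "i < J + 2" "x \<le> y" "K i x \<noteq> K i y"
  obtains g where "x < g" "g \<le> y" "g mod B = ev i" "K i g = K i y"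
proof -
  have e: "ev i < B" using ev_less assms(1) .
  have lt: "K i x < K i y"
    using K_mono[OF assms(2), of i] assms(3) by simp
  \<comment> \<open>The last place of site \<open>i\<close> at or before \<open>y\<close>: the first
    place is \<open>ev i\<close> and has number 1.\<close>
  define g where "g = ev i + B * (K i y - 1)"
  have "B * K i y \<le> y + B - ev i"
    unfolding K_def by (metis mult.commute div_times_less_eq_dividend)
  then have le: "g \<le> y"
    unfolding g_def using lt e by (cases "K i y") auto
  have Kg: "K i g = K i y"
    unfolding g_def using K_add_B[OF assms(1), of "ev i" "K i y - 1"] lt B_pos
    by (simp add: K_def mult.commute)
  have "x < g"
    using K_mono[of g x i] Kg lt by (cases "x < g") simp_all
  moreover have "g mod B = ev i"
    unfolding g_def using e by simp
  ultimately show thesis using that le Kg by blast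
qed

lemma Moving_next:
  assumes "even (j mod N)"
  shows "\<exists>j'\<in>{j + 1, j + 2}. bas j' = Moving (((j div N * l + j mod N div 2) + 1) mod (l + 1))"
proof (cases "j mod N + 2 < N")
  case True
  then have "(j + 2) mod N = j mod N + 2" "(j + 2) div N = j div N"
    using div_mod_eqI[of "j mod N + 2" "j + 2" "j div N"] by simp_all
  then show ?thesis
    using assms by (auto simp: bas_eq_Moving)
next
  case False
  have lt: "j mod N < N" using N_pos by simp
  have eq: "j div N * N + j mod N = j" by simp
  obtain c where c: "j mod N = 2 * c" using assms by auto
  define r where "r = j div N"
  have j: "j = r * N + 2 * c" using eq c r_def by simp
  \<comment> \<open>Distance from the last even column to the start of the next row: 1 if
    \<open>N\<close> is odd, 2 if it is even.\<close>
  define e where "e = N - 2 * c"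
  have e: "e = 1 \<or> e = 2" "2 * c + e = N" "c + 1 = l"
    using False lt c N_cases unfolding e_def by auto
  have "j + e = (r + 1) * N"
    using j e by simp
  then have d: "(j + e) div N = r + 1" "(j + e) mod N = 0"
    using N_pos by simp_all
  have "bas (j + e) = Moving ((r + 1) * l mod (l + 1))"
    using d by (simp add: bas_eq_Moving)
  moreover have "(r + 1) * l = r * l + c + 1" using e(3) by (simp only: distrib_right mult_1 add.assoc)
  moreover have "j mod N div 2 = c" using c by simp
  ultimately have "bas (j + e) = Moving ((r * l + j mod N div 2 + 1) mod (l + 1))"
    by (simp only:)
  then show ?thesis using e(1) unfolding r_def by blast
qed

lemma X_mono: "k \<le> k' \<Longrightarrow> X i k \<le> X i k'"
  unfolding X_def by (rule sum_mono2) auto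

lemma K_less_event: "i < J + 2 \<Longrightarrow> g mod B = ev i \<Longrightarrow> x < g \<Longrightarrow> K i x < K i g"
proof -
  assume i: "i < J + 2" and g: "g mod B = ev i" and x: "x < g"
  define t where "t = g div B"
  have gt: "g = t * B + ev i" using g unfolding t_def by (metis div_mult_mod_eq)
  have e: "ev i < B" using ev_less[OF i] .
  have "K i g = (B + t * B) div B"
    unfolding K_def gt by (simp add: add.commute)
  then have "K i g = t + 1" using B_pos by simp
  moreover have "x + B - ev i < (t + 1) * B"
    using x e B_pos unfolding gt by simp
  then have "K i x < t + 1" unfolding K_def by (metis less_mult_imp_div_less)
  ultimately show ?thesis by simp
qed

text \<open>Up to distance \<open>B\<close> the place counter grows by at most one, so a site
  rotates at most once between \<open>x\<close> and \<open>y\<close>. Without a rotation the slots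
  agree; with one, the slot at \<open>y\<close> is one less modulo 4, which leaves four
  pairs.\<close>

lemma eq_step_cases:
  assumes eq: "w x = w y" and le: "x \<le> y" "y \<le> x + B"
  obtains (untouched) "\<not> touched (bas y)" "bas y = bas x"
  | (still) i d where "i < J + 2" "d < 4" "bas x = sl i d" "bas y = sl i d"
      "X i (K i x) = X i (K i y)"
  | (move) i d d' g where "i < J + 2" "bas x = sl i d" "bas y = sl i d'"
      "(d, d') \<in> {(1, 0), (2, 1), (3, 2), (0, 3)}" "x < g" "g \<le> y" "g mod B = ev i" "eps i (K i g) = 1"
  using eq
proof (cases rule: w_eq_cases)
  case untouched
  then show thesis using that(1) by blast
next
  case (site i d d')
  let ?k = "K i x" and ?k' = "K i y"
  have k: "?k \<le> ?k'" "?k' \<le> ?k + 1"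
    using K_mono[OF le(1)] K_step[OF site(1) le(2)] by simp_all
  show thesis
  proof (cases "X i ?k = X i ?k'")
    case True
    then have "(d + X i ?k) mod 4 = (d' + X i ?k) mod 4" using site by simp
    then have "d mod 4 = d' mod 4" by (rule add_mod4_cancel)
    then have "d = d'" using site by simp
    then show thesis using that(2) site True by blast
  next
    case False
    then have k': "?k' = Suc ?k" using k by (cases "?k = ?k'") simp_all
    have X: "X i ?k' = X i ?k + 1" and e: "eps i ?k' = 1"
      using False eps_le[of i ?k'] unfolding k' X_Suc by auto
    obtain g where g: "x < g" "g \<le> y" "g mod B = ev i" "K i g = ?k'"
      using K_event[OF site(1) le(1)] k' by auto
    have "(d + X i ?k) mod 4 = (d' + 1 + X i ?k) mod 4" using site X by (simp add: ac_simps)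
    then have "d mod 4 = (d' + 1) mod 4" by (rule add_mod4_cancel)
    then have "(d, d') \<in> {(1, 0), (2, 1), (3, 2), (0, 3)}"
      using site(2,3) unfolding less4 by auto
    then show thesis using that(3) site g e by metis
  qed
qed

lemma still_no_event:
  assumes "i < J + 2" "X i (K i x) = X i (K i y)" "x < g" "g \<le> y" "g mod B = ev i"
  shows "eps i (K i g) = 0"
proof -
  obtain k where k: "K i g = Suc k" "K i x \<le> k"
    using K_less_event[OF assms(1,5,3)] by (cases "K i g") auto
  have "X i (K i x) \<le> X i k" using X_mono k by blast
  moreover have "X i (K i g) \<le> X i (K i y)" using X_mono K_mono assms(4) by blast
  ultimately show ?thesis using assms(2) unfolding k(1) X_Suc by simp
qed

section \<open>Recurrence distances and periods below \<open>2 * N\<close>\<close>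

lemma event_block:
  assumes i: "i < J + 2" and g: "g mod B = ev i"
  shows "g mod N = 2 * fx i + 1" "bas g = sl i 0" "bas (g + 1) = sl i 1" "bas (g + 2) = sl i 3"
    "bas (g + 3) = sl i 2"
proof -
  define A where "A = fx i + (l + 2) - mv i"
  define r where "r = A mod (l + 1) + g div B * (l + 1)"
  have "g = g div B * B + ev i" using g by (metis div_mult_mod_eq)
  then have gr: "g = r * N + (2 * fx i + 1)"
    unfolding r_def ev_def B_def A_def by (simp add: algebra_simps)
  have f: "fx i + 3 \<le> phi" "2 * phi \<le> N" using fx_range[OF i] params by simp_all
  show c: "g mod N = 2 * fx i + 1"
    by (rule div_mod_eqI(2)[OF _ gr]) (use f in simp)
  have d: "(g + k) div N = r" "(g + k) mod N = 2 * fx i + 1 + k" if "k \<le> 3" for k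
    using div_mod_eqI[of "2 * fx i + 1 + k" "g + k" r] f that gr by simp_all
  \<comment> \<open>Since \<open>l\<close> is -1 modulo \<open>l + 1\<close>, the sum is congruent
    to \<open>fx i + 1 - r\<close>, and \<open>r\<close> to \<open>fx i + 1 - mv i\<close>.\<close>
  have v: "(r * l + fx i + 1) mod (l + 1) = mv i"
  proof -
    have "r mod (l + 1) = A mod (l + 1)" unfolding r_def by (simp only: mod_mult_self1 mod_mod_trivial)
    then have "(r * l + (fx i + 1) + (l + 1)) mod (l + 1) = (A * l + (fx i + 1) + (l + 1)) mod (l + 1)"
      by (intro mod_add_cong mod_mult_cong refl)
    also have "A * l + (fx i + 1) + (l + 1) = mv i + A * (l + 1)"
      using mv_range[OF i] unfolding A_def by simp
    finally have "(r * l + (fx i + 1)) mod (l + 1) = mv i mod (l + 1)" by (simp only: mod_add_self2 mod_mult_self1)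
    then show ?thesis using mv_range[OF i] by (simp add: add.assoc)
  qed
  show "bas g = sl i 0" using c by (simp add: bas_eq_Fixed)
  show "bas (g + 2) = sl i 3" using d[of 2] by (simp add: bas_eq_Fixed)
  show "bas (g + 1) = sl i 1" using d[of 1] v by (simp add: bas_eq_Moving)
  have "(r * l + fx i + 1 + 1) mod (l + 1) = (mv i + 1) mod (l + 1)"
    using v by (metis mod_add_left_eq)
  then show "bas (g + 3) = sl i 2" using d[of 3] mv_range[OF i] by (simp add: bas_eq_Moving)
qed

text \<open>The next copy of a moving letter is one row down and two columns to the right, or, from
  the last even column, at the start of the row after that; for odd \<open>N\<close> this saves one
  position. The copy after the next is at distance at least \<open>2 * N + 3\<close>, whence the
  bound.\<close>

lemma moving_dist:
  assumes "x < y" "y < x + 2 * N + 3" "bas x = Moving u" "bas y = Moving u"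
  shows "y = x + N + 2 \<and> (y mod N \<noteq> 0 \<or> even N) \<or> y = x + N + 1 \<and> y mod N = 0 \<and> odd N"
proof -
  obtain a where a: "x mod N = 2 * a" using assms bas_eq_Moving by blast
  obtain b where b: "y mod N = 2 * b" using assms bas_eq_Moving by blast
  define r where "r = x div N"
  have x: "x = r * N + 2 * a" using a unfolding r_def by (metis div_mult_mod_eq)
  have "r \<le> y div N" unfolding r_def using assms by (intro div_le_mono) simp
  then obtain q where q: "y div N = r + q" using le_Suc_ex by blast
  have y: "y = r * N + q * N + 2 * b" using b q by (metis div_mult_mod_eq add_mult_distrib)
  have al: "2 * a < N" "2 * b < N" using a b N_pos mod_less_divisor by metis+
  then have al': "a < l" "b < l" using params by simp_all
  have "\<not> 4 \<le> q"
  proof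
    assume "4 \<le> q"
    then have "4 * N \<le> q * N" by (rule mult_le_mono1)
    then show False using assms(2) x y al params(2) by linarith
  qed
  then have q4: "q = 0 \<or> q = 1 \<or> q = 2 \<or> q = 3" by auto
  have v: "(r * l + a) mod (l + 1) = u" "((r + q) * l + b) mod (l + 1) = u"
    using assms(3,4) a b q unfolding bas_eq_Moving r_def by simp_all
  have lt: "r * l + a < (r + q) * l + b"
    using q4 assms(1) al' x y by (elim disjE) (simp_all add: algebra_simps)
  then have "(l + 1) dvd ((r + q) * l + b) - (r * l + a)"
    using v by (metis less_imp_le mod_eq_dvd_iff_nat)
  moreover have "((r + q) * l + b) - (r * l + a) = q * l + b - a" by (simp add: algebra_simps)
  ultimately have "(l + 1) dvd q * l + b - a" by simp
  \<comment> \<open>\<open>h\<close> counts the rounds of the moving letters between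
    \<open>x\<close> and \<open>y\<close>; the distance bound will leave only
    \<open>h = 1\<close>.\<close>
  then obtain h where h: "q * l + b - a = (l + 1) * h" by blast
  have pos: "a < q * l + b" using lt by (simp add: algebra_simps)
  have par: "N = 2 * l \<and> even N \<or> N + 1 = 2 * l \<and> odd N"
  proof (cases "even N")
    case True
    then have "N + 1 \<noteq> 2 * l" by presburger
    then show ?thesis using N_cases True by blast
  next
    case False
    then have "N \<noteq> 2 * l" by presburger
    then show ?thesis using N_cases False by blast
  qed
  have hh: "q * l + b = (l + 1) * h + a" using h pos by simp
  have h3: "h < 4"
  proof (rule ccontr)
    assume "\<not> h < 4"
    then have "(l + 1) * 4 \<le> (l + 1) * h" by (intro mult_left_mono) simp_all
    then show False using q4 al' hh by auto
  qed
  have "h \<noteq> 0" using hh pos by auto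
  then have h: "h = 1 \<or> h = 2 \<or> h = 3" using h3 by auto
  from q4 show ?thesis
  proof (elim disjE)
    assume "q = 0"
    then show ?thesis using hh al' h by auto
  next
    assume "q = 1"
    have "h = 1" and "b = a + 1" using hh al' h \<open>q = 1\<close> by auto
    then show ?thesis using x y b \<open>q = 1\<close> by simp
  next
    assume [simp]: "q = 2"
    consider "h = 1" "l + b = a + 1" | "h = 2" "b = a + 2" using hh al' h by auto
    then show ?thesis
    proof cases
      case 1
      then have "b = 0" "a + 1 = l" using al' by auto
      then show ?thesis using par x y b by auto
    next
      case 2
      then show ?thesis using assms x y by simp
    qed
  next
    assume [simp]: "q = 3"
    consider "h = 2" "l + b = a + 2" | "h = 3" "b = a + 3" using hh al' h by auto
    then show ?thesis using par x y assms al' params(1) by cases auto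
  qed
qed

text \<open>Recorded in the cases of \<open>near_cases\<close> other than \<open>event\<close>: the
  site of the base letter at \<open>y\<close> has not rotated since \<open>x\<close>. A neighbouring
  position that reveals such a rotation gives a contradiction.\<close>

definition unbroken :: "nat \<Rightarrow> nat \<Rightarrow> bool" where
  "unbroken x y \<longleftrightarrow> (\<forall>i<J + 2. \<forall>g d. x < g \<and> g \<le> y \<and> g mod B = ev i \<and> eps i (K i g) = 1 \<and> d < 4
      \<longrightarrow> bas y \<noteq> sl i d)"

lemma unbrokenD:
  "\<lbrakk>unbroken x y; i < J + 2; x < g; g \<le> y; g mod B = ev i; eps i (K i g) = 1; d < 4\<rbrakk> \<Longrightarrow> bas y \<noteq> sl i d"
  unfolding unbroken_def by blast

lemma mod_N_eqD:
  assumes "x mod N = y mod N" "x < y"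
  obtains k where "y = x + N + k * N"
proof -
  have "N dvd y - x" using assms by (metis less_imp_le mod_eq_dvd_iff_nat)
  then obtain k where k: "y - x = N * k" by blast
  with assms(2) have "k \<noteq> 0" by (intro notI) simp
  then obtain k' where "k = Suc k'" using not0_implies_Suc by blast
  with k assms(2) have "y = x + N + k' * N" by (simp add: algebra_simps)
  then show thesis by (rule that)
qed

lemma event_col:
  assumes "i < J + 2" "g mod B = ev i" "k \<le> 4"
  shows "(g + k) mod N = 2 * fx i + 1 + k"
proof -
  have "2 * fx i + 6 \<le> N" using fx_range[OF assms(1)] params by simp
  then have "(g mod N + k) mod N = g mod N + k"
    using event_block(1)[OF assms(1,2)] assms(3) by simp
  then show ?thesis
    using event_block(1)[OF assms(1,2)] by (metis mod_add_left_eq)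
qed


text \<open>The alternatives in case \<open>event\<close> are the four slots at the place \<open>g\<close> where the rotation happens.\<close>

lemma near_cases:
  assumes eq: "w x = w y" and lt: "x < y" "y < x + 2 * N"
  obtains (fixed) "odd (y mod N)" "y = x + N" "unbroken x y"
  | (moving) "even (y mod N)" "unbroken x y"
      "y = x + N + 2 \<and> (y mod N \<noteq> 0 \<or> even N) \<or> y = x + N + 1 \<and> y mod N = 0 \<and> odd N"
  | (event) i g where "i < J + 2" "g mod B = ev i" "x < g" "eps i (K i g) = 1"
      "y = g \<and> y = x + N + 1 \<or> y = g + 1 \<and> y = x + N \<or> y = g + 2 \<and> y = x + N + 2
       \<or> y = g + 3 \<and> y = x + N + 1"
proof -
  \<comment> \<open>Equal base letters recur at the distances of the base word: in the same column
    if fixed, by \<open>moving_dist\<close> if moving.\<close>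
  have same: thesis if b: "bas y = bas x" and u: "unbroken x y"
  proof (cases "bas x")
    case (Fixed f)
    then have "bas y = Fixed f" using b by simp
    with Fixed have c: "x mod N = 2 * f + 1" "y mod N = 2 * f + 1" unfolding bas_eq_Fixed by blast+
    then obtain k where "y = x + N + k * N" using mod_N_eqD[of x y] lt by metis
    then have "y = x + N" using lt by (cases k) simp_all
    then show thesis using fixed c u by simp
  next
    case (Moving v)
    then have "bas y = Moving v" using b by simp
    then show thesis using moving u moving_dist[OF lt(1) _ Moving] lt(2) by (simp add: bas_eq_Moving)
  qed
  have le: "x \<le> y" "y \<le> x + B" using lt N2_le_B by simp_all
  show thesis
    using eq le
  proof (cases rule: eq_step_cases)
    case untouched
    then have "bas y \<noteq> sl i d" if "i < J + 2" "d < 4" for i d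
      using that unfolding touched_def by blast
    then have "unbroken x y" unfolding unbroken_def by simp
    with untouched(2) show thesis by (rule same)
  next
    case (still i d)
    have "unbroken x y"
      unfolding unbroken_def
    proof (intro allI impI notI)
      fix i' g d'
      assume "i' < J + 2" and g: "x < g \<and> g \<le> y \<and> g mod B = ev i' \<and> eps i' (K i' g) = 1 \<and> d' < 4"
        and "bas y = sl i' d'"
      then have "i' = i" using sl_inj[of i' i d' d] still(1,2,4) by metis
      then have "eps i (K i g) = 0" using still_no_event[OF still(1,5)] g by blast
      then show False using g \<open>i' = i\<close> by simp
    qed
    moreover have "bas y = bas x" using still by simp
    ultimately show thesis by (intro same)
  next
    case (move i d d' g)
    note blk = event_block[OF move(1,7)]
    have N26: "26 \<le> N" using params by simp
    have c: "g mod N = 2 * fx i + 1" using blk by simp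
    note c1 = event_col[OF move(1,7)]
    have md: "v = u + N + 2 \<or> v = u + N + 1 \<and> v mod N = 0"
      if "bas u = Moving a" "bas v = Moving a" "u < v" "v < u + 2 * N + 3" for u v a
      using moving_dist[OF that(3,4,1,2)] by blast
    \<comment> \<open>Both ends are tied to the block at \<open>g\<close>: the base letter at
      \<open>x\<close> recurs in this block after its usual distance, and the base letter at
      \<open>y\<close> is the block's own copy, since other copies are at least a row away.\<close>
    have "y = g \<and> y = x + N + 1 \<or> y = g + 1 \<and> y = x + N \<or> y = g + 2 \<and> y = x + N + 2
       \<or> y = g + 3 \<and> y = x + N + 1"
    proof -
      consider "d = 1" "d' = 0" | "d = 2" "d' = 1" | "d = 3" "d' = 2" | "d = 0" "d' = 3"
        using move(4) by auto
      then show ?thesis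
      proof cases
        case 1
        then have bx: "bas x = Moving (mv i)" and by': "bas y = Fixed (fx i)" and bg: "bas (g + 1) = Moving (mv i)"
          using move blk by simp_all
        have "x < g + 1" "g + 1 < x + 2 * N + 3" using move(5,6) lt by simp_all
        from md[OF bx bg this] have gx: "g + 1 = x + N + 2" using c1[of 1] by auto
        have "y = g"
        proof (rule ccontr)
          assume "y \<noteq> g"
          moreover have "g mod N = y mod N" using by' c unfolding bas_eq_Fixed by simp
          ultimately obtain k where "y = g + N + k * N"
            using mod_N_eqD[of g y] move(6) by (metis le_neq_implies_less)
          then show False using lt gx by simp
        qed
        with gx show ?thesis by simp
      next
        case 2
        then have bx: "bas x = Moving (mv i + 1)" and by': "bas y = Moving (mv i)"
          and bg: "bas (g + 1) = Moving (mv i)" "bas (g + 3) = Moving (mv i + 1)"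
          using move blk by simp_all
        have "y \<noteq> g" using by' blk(2) by auto
        then have yg: "g + 1 \<le> y" using move(6) by simp
        then have "x < g + 3" "g + 3 < x + 2 * N + 3" using move(5) lt by simp_all
        from md[OF bx bg(2) this] have "g + 3 = x + N + 2" using c1[of 3] by auto
        moreover have "y = g + 1"
        proof (rule ccontr)
          assume "y \<noteq> g + 1"
          then have "g + 1 < y" "y < g + 1 + 2 * N + 3" using yg lt move(5) by simp_all
          from md[OF bg(1) by' this] show False using lt \<open>g + 3 = x + N + 2\<close> by auto
        qed
        ultimately show ?thesis by simp
      next
        case 3
        then have bx: "bas x = Fixed (fx i + 1)" and by': "bas y = Moving (mv i + 1)"
          and bg: "bas (g + 2) = Fixed (fx i + 1)" "bas (g + 3) = Moving (mv i + 1)"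
          using move blk by simp_all
        have cx: "x mod N = (g + 2) mod N" using bx bg(1) unfolding bas_eq_Fixed by simp
        have "x < g + 2" using move(5) by simp
        with mod_N_eqD[OF cx] obtain k where k: "g + 2 = x + N + k * N" by metis
        have "\<not> y < g + 3"
        proof
          assume "y < g + 3"
          moreover from this have "g + 3 < y + 2 * N + 3" using move(6) N26 by simp
          ultimately show False using md[OF by' bg(2)] move(6) N26 by auto
        qed
        moreover have "\<not> g + 3 < y"
        proof
          assume "g + 3 < y"
          moreover from this have "y < g + 3 + 2 * N + 3" using lt move(5) by simp
          ultimately show False using md[OF bg(2) by'] k lt by auto
        qed
        ultimately have "y = g + 3" by simp
        then show ?thesis using k lt by (cases k) simp_all
      next
        case 4
        then have bx: "bas x = Fixed (fx i)" and by': "bas y = Fixed (fx i + 1)"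
          and bg: "bas g = Fixed (fx i)" "bas (g + 2) = Fixed (fx i + 1)"
          using move blk by simp_all
        have cx: "x mod N = g mod N" using bx bg(1) unfolding bas_eq_Fixed by simp
        with mod_N_eqD[OF cx] move(5) obtain k where k: "g = x + N + k * N" by metis
        have cy: "y mod N = (g + 2) mod N" using by' bg(2) unfolding bas_eq_Fixed by simp
        have "\<not> y < g + 2"
        proof
          assume "y < g + 2"
          with mod_N_eqD[OF cy] obtain k' where "g + 2 = y + N + k' * N" by metis
          then show False using move(6) N26 by simp
        qed
        moreover have "\<not> g + 2 < y"
        proof
          assume "g + 2 < y"
          with mod_N_eqD[OF cy[symmetric]] obtain k' where "y = g + 2 + N + k' * N" by metis
          then show False using k lt by simp
        qed
        ultimately have "y = g + 2" by simp
        then show ?thesis using k lt by (cases k) simp_all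
      qed
    qed
    then show thesis using that(3)[OF move(1,7,5,8)] by blast
  qed
qed

lemma mod_N_Suc: "(y + 1) mod N = (if y mod N + 1 = N then 0 else y mod N + 1)"
  by (simp add: mod_Suc)

text \<open>Two adjacent positions would have to recur at the same distance. Outside rotations fixed
  letters recur at \<open>N\<close> and moving ones at \<open>N + 1\<close> or \<open>N + 2\<close>;
  the four positions of a rotating block recur at \<open>N + 1\<close>, \<open>N\<close>,
  \<open>N + 2\<close>, \<open>N + 1\<close>. Where a block meets its surroundings at equal
  distances, \<open>unbroken\<close> or the columns decide; two blocks conflict by parity,
  \<open>fx_sep\<close> or \<open>fx_mv_cross\<close>.\<close>

lemma near_no_run:
  assumes e: "w x = w y" "w (x + 1) = w (y + 1)" and lt: "x < y" "y < x + 2 * N"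
  shows False
  using e(1) lt
proof (cases rule: near_cases)
  case fixed
  have lt': "x + 1 < y + 1" "y + 1 < x + 1 + 2 * N" using lt by simp_all
  show False
    using e(2) lt'
  proof (cases rule: near_cases)
    case f2: fixed
    then show False using fixed(1) unfolding mod_N_Suc by (simp split: if_splits)
  next
    case moving
    then show False using fixed(2) by auto
  next
    case (event i g)
    then have "y = g" using fixed(2) params(2) by auto
    then show False
      using unbrokenD[OF fixed(3) event(1) _ _ event(2,4), of 0] event_block(2)[OF event(1,2)] lt by simp
  qed
next
  case moving
  have lt': "x + 1 < y + 1" "y + 1 < x + 1 + 2 * N" using lt by simp_all
  show False
    using e(2) lt'
  proof (cases rule: near_cases)
    case fixed
    then show False using moving by auto
  next
    case m2: moving
    \<comment> \<open>Two moving letters are adjacent only across a row boundary with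
      \<open>N\<close> odd, and then they recur at the different distances \<open>N + 2\<close> and
      \<open>N + 1\<close>.\<close>
    then have "y mod N + 1 = N" using moving(1) unfolding mod_N_Suc by (simp split: if_splits)
    moreover from this have "odd N" using moving(1) by (metis even_plus_one_iff)
    ultimately have "y mod N \<noteq> 0" "odd N" "(y + 1) mod N = 0" using moving(1) params(2) unfolding mod_N_Suc by auto
    then show False using moving(3) m2(3) by auto
  next
    case (event i g)
    note c = event_col[OF event(1,2)]
    from event(5) consider "y + 1 = g" "y = x + N + 1" | "y = g + 1" "y = x + N + 2" | "y = g + 2"
      using moving(3) by auto
    then show False
    proof cases
      case 1
      \<comment> \<open>At distance \<open>N + 1\<close> a moving letter stands in column 0, while
        blocks start in column 3 or later because \<open>1 \<le> fx i\<close>.\<close>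
      then have "y mod N = 0" using moving(3) by auto
      moreover have "(y + 1) mod N = 2 * fx i + 1" using c[of 0] 1 by simp
      moreover have "1 \<le> fx i" using fx_range[OF event(1)] by simp
      ultimately show False unfolding mod_N_Suc using params(2) by simp
    next
      case 2
      then show False
        using unbrokenD[OF moving(2) event(1) _ _ event(2,4), of 1] event_block(3)[OF event(1,2)] params(2) by simp
    next
      case 3
      then show False using c[of 2] moving(1) by simp
    qed
  qed
next
  case (event i g)
  note c = event_col[OF event(1,2)]
  have lt': "x + 1 < y + 1" "y + 1 < x + 1 + 2 * N" using lt by simp_all
  show False
    using e(2) lt'
  proof (cases rule: near_cases)
    case fixed
    then have "y + 1 = g + 2" using event(5) by auto
    then show False
      using unbrokenD[OF fixed(3) event(1) _ _ event(2,4), of 3] event_block(4)[OF event(1,2)] fixed(2) params(2) by simp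
  next
    case moving
    from event(5) consider "y = g" "y = x + N + 1" | "y = g + 2" | "y = g + 3"
      using moving(3) by auto
    then show False
    proof cases
      case 1
      then show False using moving(3) c[of 1] by simp
    next
      case 2
      then have y: "y + 1 = g + 3" by simp
      then have "bas (y + 1) = sl i 2" using event_block(5)[OF event(1,2)] by (simp only:)
      moreover have "x + 1 < g" "g \<le> y + 1" using 2 event(5) params(2) by auto
      ultimately show False
        using unbrokenD[OF moving(2) event(1) _ _ event(2,4), of 2] by simp
    next
      case 3
      then have "y + 1 = g + 4" by simp
      then have "even (2 * fx i + 1 + 4)" using c[of 4] moving(1) by (simp only: order_refl)
      then show False by presburger
    qed
  next
    case ev2: (event j h)
    note c' = event_col[OF ev2(1,2)]
    have "y = g \<and> y + 1 = h \<or> y = g \<and> y + 1 = h + 3 \<or> y = g + 1 \<and> y + 1 = h + 1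
      \<or> y = g + 2 \<and> y + 1 = h + 2 \<or> y = g + 3 \<and> y + 1 = h \<or> y = g + 3 \<and> y + 1 = h + 3"
      using event(5) ev2(5) by (elim disjE conjE) simp_all
    then consider "y = g" "y + 1 = h" | "y = g" "y + 1 = h + 3" | "y = g + 1" "y + 1 = h + 1"
      | "y = g + 2" "y + 1 = h + 2" | "y = g + 3" "y + 1 = h" | "y = g + 3" "y + 1 = h + 3"
      by blast
    then show False
    proof cases
      case 1
      then have "(g + 1) mod N = (h + 0) mod N" by simp
      then have "2 * fx i + 2 = 2 * fx j + 1" using c[of 1] c'[of 0] by simp
      then show False by presburger
    next
      case 2
      then have "g + 1 = h + 3" by simp
      then have "(g + 1) mod N = (h + 3) mod N" by (simp only:)
      then have "fx i = fx j + 1" using c[of 1] c'[of 3] by simp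
      then show False using fx_sep event(1) ev2(1) by blast
    next
      case 3
      then have "(g + 1) mod N = (h + 0) mod N" by simp
      then have "2 * fx i + 2 = 2 * fx j + 1" using c[of 1] c'[of 0] by simp
      then show False by presburger
    next
      case 4
      then have "(g + 1) mod N = (h + 0) mod N" by simp
      then have "2 * fx i + 2 = 2 * fx j + 1" using c[of 1] c'[of 0] by simp
      then show False by presburger
    next
      case 5
      \<comment> \<open>The second block follows the first immediately in the same row, so the
        cyclic order of the moving letters gives \<open>mv j = mv i + 2\<close>.\<close>
      then have h: "h = g + 4" by simp
      have "(g + 4) mod N = (h + 0) mod N" using h by simp
      then have f: "fx j = fx i + 2" using c[of 4] c'[of 0] by simp
      have g3: "even ((g + 3) mod N)" "(g + 3) mod N + 2 < N"
        using c[of 3] fx_range[OF ev2(1)] f params by simp_all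
      have "(g + 3 + 2) div N = (g + 3) div N \<and> (g + 3 + 2) mod N = (g + 3) mod N + 2"
        using div_mod_eqI[OF g3(2), of "g + 3 + 2" "(g + 3) div N"] by simp
      moreover have "bas (g + 3) = Moving (mv i + 1)" using event_block(5)[OF event(1,2)] by simp
      moreover have "bas (g + 3 + 2) = Moving (mv j)" using event_block(3)[OF ev2(1,2)] h by simp
      ultimately have "mv j = ((g + 3) div N * l + (g + 3) mod N div 2 + 1) mod (l + 1)"
        "((g + 3) div N * l + (g + 3) mod N div 2) mod (l + 1) = mv i + 1"
        unfolding bas_eq_Moving by simp_all
      then have "mv j = (mv i + 1 + 1) mod (l + 1)" by (metis mod_add_left_eq)
      then have "mv j = mv i + 2" using mv_range[OF event(1)] by simp
      then show False using fx_mv_cross[OF event(1) ev2(1) f] by simp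
    next
      case 6
      then have "(g + 1) mod N = (h + 0) mod N" by simp
      then have "2 * fx i + 2 = 2 * fx j + 1" using c[of 1] c'[of 0] by simp
      then show False by presburger
    qed
  qed
qed

lemma near_ge:
  assumes "w x = w y" "x < y"
  shows "x + N \<le> y"
proof (rule ccontr)
  assume "\<not> x + N \<le> y"
  then have lt: "y < x + N" "y < x + 2 * N" by simp_all
  show False
    using assms lt(2) by (cases rule: near_cases) (use lt(1) in auto)
qed

section \<open>Periods from \<open>2 * N\<close> up to \<open>B\<close>\<close>

text \<open>Each of the four moves in \<open>eq_step_cases\<close> has its own pattern of fixed and
  moving letters, so the kinds of the two base letters identify the only possible move.\<close>

lemma step_simps:
  assumes "w x = w y" "x \<le> y" "y \<le> x + B"
  shows "\<lbrakk>bas x = Fixed f; bas y = Fixed f'\<rbrakk> \<Longrightarrow> f' = f \<or> f' = f + 1 \<and> (\<exists>i<J + 2. f = fx i)"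
    and "\<lbrakk>bas x = Moving u; bas y = Moving u'\<rbrakk> \<Longrightarrow> u = u' \<or> u = u' + 1 \<and> (\<exists>i<J + 2. u' = mv i)"
    and "\<lbrakk>bas x = Fixed f; bas y = Moving u\<rbrakk> \<Longrightarrow> \<exists>i<J + 2. f = fx i + 1 \<and> u = mv i + 1"
    and "\<lbrakk>bas x = Moving u; bas y = Fixed f\<rbrakk> \<Longrightarrow> \<exists>i<J + 2. u = mv i \<and> f = fx i"
  using assms by (cases rule: eq_step_cases; auto)+

lemma untouched_eq:
  assumes "w x = w y" "\<not> touched (bas x) \<or> \<not> touched (bas y)"
  shows "bas x = bas y"
  using assms touched_w w_untouched by metis

lemma dvd_mult_l: "(l + 1) dvd q * l \<Longrightarrow> (l + 1) dvd q"
proof -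
  assume "(l + 1) dvd q * l"
  moreover have "q * l + q = q * (l + 1)" by simp
  ultimately show ?thesis by (metis dvd_add_right_iff dvd_triv_right)
qed

text \<open>Going down \<open>q\<close> rows in one column lowers the moving index by
  \<open>q\<close> modulo \<open>l + 1\<close>. Equal letters allow a drop of 0 without a rotation
  and of 1 with one, and \<open>q\<close> is congruent to neither.\<close>

lemma moving_same_col:
  assumes "w x = w y" "even (x mod N)" "y = x + q * N" "2 \<le> q" "q \<le> l"
  shows False
proof -
  define a where "a = x div N * l + x mod N div 2"
  have bx: "bas x = Moving (a mod (l + 1))"
    using assms(2) unfolding bas_def a_def by simp
  have "y mod N = x mod N" "y div N = x div N + q" using assms(3) N_pos by simp_all
  then have by': "bas y = Moving ((a + q * l) mod (l + 1))"
    using assms(2) unfolding bas_def a_def by (simp add: algebra_simps)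
  have "q * N \<le> l * N" using assms(5) by simp
  also have "\<dots> \<le> B" by (simp add: B_def)
  finally have "q * N \<le> B" .
  then have le: "x \<le> y" "y \<le> x + B" using assms(3) by simp_all
  from step_simps(2)[OF assms(1) le bx by']
  show False
  proof
    assume "a mod (l + 1) = (a + q * l) mod (l + 1)"
    then have "(l + 1) dvd q * l" by (metis mod_eq_dvd_iff_nat le_add1 add_diff_cancel_left')
    then have "(l + 1) dvd q" by (rule dvd_mult_l)
    then show False using assms(4,5) by (auto dest: dvd_imp_le)
  next
    assume "a mod (l + 1) = (a + q * l) mod (l + 1) + 1 \<and> (\<exists>i<J + 2. (a + q * l) mod (l + 1) = mv i)"
    then have "a mod (l + 1) = ((a + q * l) mod (l + 1) + 1) mod (l + 1)" by (metis mod_mod_trivial)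
    then have "a mod (l + 1) = (a + (q * l + 1)) mod (l + 1)" by (simp only: mod_add_left_eq add.assoc)
    then have "(l + 1) dvd q * l + 1" by (metis mod_eq_dvd_iff_nat le_add1 add_diff_cancel_left')
    moreover have "(q * l + 1) + (q - 1) = q * (l + 1)" using assms(4) by simp
    ultimately have "(l + 1) dvd q - 1" by (metis dvd_add_right_iff dvd_triv_right)
    then show False using assms(4,5) by (auto dest!: dvd_imp_le)
  qed
qed

lemma untouched_Fixed_ends: "\<not> touched (Fixed 0)" "\<not> touched (Fixed (phi - 1))"
  unfolding touched_Fixed using fx_range by fastforce+

text \<open>Three positions that cross a row boundary include the first or the last odd column,
  whose letters belong to no site.\<close>

lemma wrap_untouched:
  assumes "N \<le> z mod N + 2"
  obtains k f where "k \<le> 2" "bas (z + k) = Fixed f" "\<not> touched (Fixed f)"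
proof -
  have lt: "z mod N < N" using N_pos by simp
  then consider "z mod N = N - 1" | "z mod N = N - 2" "N = 2 * phi" | "z mod N = N - 2" "N = 2 * phi + 1"
    using assms params by linarith
  then show thesis
  proof cases
    case 1
    then have "z mod N + 2 = 1 + N" using lt by simp
    then have "(z + 2) mod N = (1 + N) mod N" by (metis mod_add_left_eq)
    also have "\<dots> = 1 mod N" by (rule mod_add_self2)
    finally have "(z + 2) mod N = 2 * 0 + 1" using params(2) by simp
    then have "bas (z + 2) = Fixed 0" unfolding bas_eq_Fixed .
    from that[OF _ this untouched_Fixed_ends(1)] show thesis by simp
  next
    case 2
    then have "z mod N + 1 = 2 * (phi - 1) + 1" "2 * (phi - 1) + 1 < N" using params by simp_all
    then have "(z + 1) mod N = 2 * (phi - 1) + 1" by (metis mod_add_left_eq mod_less)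
    then have "bas (z + 1) = Fixed (phi - 1)" unfolding bas_eq_Fixed .
    from that[OF _ this untouched_Fixed_ends(2)] show thesis by simp
  next
    case 3
    then have "(z + 0) mod N = 2 * (phi - 1) + 1" using params by simp
    then have "bas (z + 0) = Fixed (phi - 1)" unfolding bas_eq_Fixed .
    from that[OF _ this untouched_Fixed_ends(2)] show thesis by simp
  qed
qed

lemma no_wrap:
  assumes "z mod N + 2 < N" "k \<le> 2"
  shows "(z + k) mod N = z mod N + k" "(z + k) div N = z div N"
  using div_mod_eqI[of "z mod N + k" "z + k" "z div N"] assms by simp_all

lemma mod_N_add_cancel: "(x + k) mod N = (y + k) mod N \<Longrightarrow> x \<le> y \<Longrightarrow> x mod N = y mod N"
  by (metis add_diff_cancel_right add_le_mono1 mod_eq_dvd_iff_nat)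

text \<open>Equal columns are excluded by \<open>moving_same_col\<close>. With different columns no
  untouched fixed letter may occur, so both triples lie inside a row and alternate in kind. Unless
  both read moving, fixed, moving, the outer letters would need two overlapping sites. In that last
  case the middle letter shifts the column by 2, and the cyclic order of the moving letters pushes
  the period beyond \<open>B\<close>.\<close>

lemma mid_no_run:
  assumes e: "\<And>k. k \<le> 2 \<Longrightarrow> w (x + k) = w (y + k)" and lt: "x + 2 * N \<le> y" "y < x + B"
  shows False
proof -
  have le: "x + k \<le> y + k" "y + k \<le> x + k + B" for k using lt by simp_all
  have col: "x mod N \<noteq> y mod N"
  proof
    assume c: "x mod N = y mod N"
    have "x < y" using lt params by simp
    with mod_N_eqD[OF c] obtain k where k: "y = x + N + k * N" by metis
    then have y: "y = x + (k + 1) * N" by simp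
    have "(k + 1) * N < (l + 1) * N" using lt(2) unfolding y B_def by (simp add: mult.commute)
    then have "k + 1 < l + 1" using mult_less_cancel2 by blast
    moreover have "2 * N \<le> (k + 1) * N" using lt(1) unfolding y by simp
    then have "2 \<le> k + 1" using N_pos mult_le_cancel2 by blast
    ultimately have q: "2 \<le> k + 1" "k + 1 \<le> l" by simp_all
    show False
    proof (cases "even (x mod N)")
      case True
      show False by (rule moving_same_col[OF e[of 0, simplified] True y q])
    next
      case False
      then have "even ((x + 1) mod N)" unfolding mod_N_Suc by simp
      moreover have "y + 1 = x + 1 + (k + 1) * N" using y by simp
      ultimately show False using moving_same_col[OF e[of 1] _ _ q] by simp
    qed
  qed
  have untouched_F: False if "bas (x + k) = Fixed f \<or> bas (y + k) = Fixed f" "\<not> touched (Fixed f)" "k \<le> 2" for k f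
  proof -
    have "bas (x + k) = bas (y + k)" using untouched_eq[OF e] that by metis
    with that(1) have "bas (x + k) = Fixed f" "bas (y + k) = Fixed f" by auto
    then have "(x + k) mod N = (y + k) mod N" unfolding bas_eq_Fixed by simp
    then show False using mod_N_add_cancel[of x k y] col lt by simp
  qed
  have "\<not> N \<le> x mod N + 2"
  proof
    assume "N \<le> x mod N + 2"
    then show False using untouched_F by (metis wrap_untouched)
  qed
  then have cx: "x mod N + 2 < N" by simp
  have "\<not> N \<le> y mod N + 2"
  proof
    assume "N \<le> y mod N + 2"
    then show False using untouched_F by (metis wrap_untouched)
  qed
  then have cy: "y mod N + 2 < N" by simp
  note nx = no_wrap[OF cx] and ny = no_wrap[OF cy]
  note s = step_simps[OF e le]
  define a where "a = x div N * l + x mod N div 2"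
  define b where "b = y div N * l + y mod N div 2"
  have xe: "bas x = Moving (a mod (l + 1))" "bas (x + 1) = Fixed (x mod N div 2)"
    "bas (x + 2) = Moving ((a + 1) mod (l + 1))" if "even (x mod N)"
    using that nx[of 1] nx[of 2] unfolding bas_def a_def by simp_all
  have ye: "bas y = Moving (b mod (l + 1))" "bas (y + 1) = Fixed (y mod N div 2)"
    "bas (y + 2) = Moving ((b + 1) mod (l + 1))" if "even (y mod N)"
    using that ny[of 1] ny[of 2] unfolding bas_def b_def by simp_all
  have xo: "bas x = Fixed (x mod N div 2)" "bas (x + 2) = Fixed (x mod N div 2 + 1)" if "odd (x mod N)"
    using that nx[of 2] unfolding bas_def by simp_all
  have yo: "bas y = Fixed (y mod N div 2)" "bas (y + 2) = Fixed (y mod N div 2 + 1)" if "odd (y mod N)"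
    using that ny[of 2] unfolding bas_def by simp_all
  have suc: "(c + 1) mod (l + 1) = mv i + 1" if "c mod (l + 1) = mv i" "i < J + 2" for c i
  proof -
    have "(c + 1) mod (l + 1) = (mv i + 1) mod (l + 1)" using that(1) by (metis mod_add_left_eq)
    then show ?thesis using mv_range[OF that(2)] by simp
  qed
  have suc2: "(c + 1) mod (l + 1) = mv i + 2" if "c mod (l + 1) = mv i + 1" "i < J + 2" for c i
  proof -
    have "(c + 1) mod (l + 1) = (mv i + 1 + 1) mod (l + 1)" using that(1) by (metis mod_add_left_eq)
    then show ?thesis using mv_range[OF that(2)] by simp
  qed
  show False
  proof (cases "even (x mod N)"; cases "even (y mod N)")
    assume p: "odd (x mod N)" "odd (y mod N)"
    note s0 = s(1)[of 0, simplified, OF xo(1)[OF p(1)] yo(1)[OF p(2)]]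
    note s2 = s(1)[of 2, simplified, OF xo(2)[OF p(1), simplified] yo(2)[OF p(2), simplified]]
    have "x mod N div 2 \<noteq> y mod N div 2"
      using col p by (metis odd_two_times_div_two_succ)
    with s0 s2 obtain i j where "i < J + 2" "j < J + 2" "x mod N div 2 = fx i" "x mod N div 2 + 1 = fx j"
      by auto
    then show False using fx_sep[of j i] by simp
  next
    assume p: "odd (x mod N)" "even (y mod N)"
    note s0 = s(3)[of 0, simplified, OF xo(1)[OF p(1)] ye(1)[OF p(2), simplified]]
    note s2 = s(3)[of 2, simplified, OF xo(2)[OF p(1), simplified] ye(3)[OF p(2), simplified]]
    from s0 s2 obtain i j where "i < J + 2" "j < J + 2" "x mod N div 2 = fx i + 1" "x mod N div 2 = fx j"
      by auto
    then show False using fx_sep[of j i] by simp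
  next
    assume p: "even (x mod N)" "odd (y mod N)"
    note s0 = s(4)[of 0, simplified, OF xe(1)[OF p(1), simplified] yo(1)[OF p(2)]]
    note s2 = s(4)[of 2, simplified, OF xe(3)[OF p(1), simplified] yo(2)[OF p(2), simplified]]
    from s0 s2 obtain i j where ij: "i < J + 2" "j < J + 2" "a mod (l + 1) = mv i" "(a + 1) mod (l + 1) = mv j"
      by auto
    then show False using suc[OF ij(3,1)] mv_sep[of j i] by simp
  next
    assume p: "even (x mod N)" "even (y mod N)"
    note s0 = s(2)[of 0, simplified, OF xe(1)[OF p(1), simplified] ye(1)[OF p(2), simplified]]
    note s1 = s(1)[of 1, simplified, OF xe(2)[OF p(1), simplified] ye(2)[OF p(2), simplified]]
    note s2 = s(2)[of 2, simplified, OF xe(3)[OF p(1), simplified] ye(3)[OF p(2), simplified]]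
    have "x mod N div 2 \<noteq> y mod N div 2"
      using col p by (metis even_two_times_div_two)
    then have "y mod N div 2 = x mod N div 2 + 1" using s1 by auto
    then have c: "y mod N = x mod N + 2"
      using p even_two_times_div_two[of "x mod N"] even_two_times_div_two[of "y mod N"] by linarith
    \<comment> \<open>A move at the first moving letter would require, at the second one, a site
      starting at \<open>mv i + 1\<close>.\<close>
    have ab: "a mod (l + 1) = b mod (l + 1)"
    proof (rule ccontr)
      assume "a mod (l + 1) \<noteq> b mod (l + 1)"
      then obtain i where i: "i < J + 2" "a mod (l + 1) = mv i + 1" "b mod (l + 1) = mv i"
        using s0 by auto
      then have "(a + 1) mod (l + 1) = mv i + 2" "(b + 1) mod (l + 1) = mv i + 1"
        using suc suc2 by blast+
      then obtain j where "j < J + 2" "mv j = mv i + 1" using s2 by auto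
      then show False using mv_sep i by blast
    qed
    have "x div N \<le> y div N" using lt by (intro div_le_mono) simp
    then obtain q where q: "y div N = x div N + q" using le_Suc_ex by blast
    have "(x div N + q) * N = x div N * N + q * N" by (rule distrib_right)
    then have yx: "y = x + q * N + 2"
      using div_mult_mod_eq[of x N] div_mult_mod_eq[of y N] unfolding q c by linarith
    have "b = a + (q * l + 1)" unfolding a_def b_def q c using p(1) by (simp add: algebra_simps)
    with ab have "(l + 1) dvd q * l + 1" by (metis mod_eq_dvd_iff_nat le_add1 add_diff_cancel_left')
    have "q \<noteq> 0"
    proof
      assume "q = 0"
      then show False using lt(1) yx params(2) by simp
    qed
    moreover have "q \<noteq> 1"
    proof
      assume "q = 1"
      then show False using lt(1) yx params(2) by simp
    qed
    moreover have "(q * l + 1) + (q - 1) = q * (l + 1)" using \<open>q \<noteq> 0\<close> by (cases q) simp_all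
    then have "(l + 1) dvd q - 1" using \<open>(l + 1) dvd q * l + 1\<close> by (metis dvd_add_right_iff dvd_triv_right)
    ultimately have "l + 1 \<le> q - 1" by (intro dvd_imp_le) simp_all
    then have "(l + 1) * N \<le> q * N" by (intro mult_le_mono1) simp
    then show False using lt(2) yx by (simp add: B_def mult.commute)
  qed
qed

section \<open>Divisibility of the period of a long run by \<open>B\<close>\<close>

lemma Moving_iter:
  assumes "even (j mod N)"
  shows "\<exists>j'. j \<le> j' \<and> j' \<le> j + 2 * k \<and> bas j' = Moving ((j div N * l + j mod N div 2 + k) mod (l + 1))"
proof (induction k)
  case 0
  then show ?case using assms by (intro exI[of _ j]) (simp add: bas_eq_Moving)
next
  case (Suc k)
  then obtain j' where j': "j \<le> j'" "j' \<le> j + 2 * k"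
    "bas j' = Moving ((j div N * l + j mod N div 2 + k) mod (l + 1))" by blast
  then have ev: "even (j' mod N)" and
    v: "(j' div N * l + j' mod N div 2) mod (l + 1) = (j div N * l + j mod N div 2 + k) mod (l + 1)"
    unfolding bas_eq_Moving by auto
  from Moving_next[OF ev] obtain h where h: "h = j' + 1 \<or> h = j' + 2"
    "bas h = Moving ((j' div N * l + j' mod N div 2 + 1) mod (l + 1))" by blast
  have "(j' div N * l + j' mod N div 2 + 1) mod (l + 1) = (j div N * l + j mod N div 2 + k + 1) mod (l + 1)"
    using v by (metis mod_add_left_eq)
  then have "bas h = Moving ((j div N * l + j mod N div 2 + Suc k) mod (l + 1))"
    using h(2) by (simp only: add.assoc Suc_eq_plus1)
  moreover have "j \<le> h" "h \<le> j + 2 * Suc k" using j' h(1) by auto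
  ultimately show ?case by blast
qed

lemma col_hit:
  assumes "t < N"
  shows "a mod N \<le> t \<Longrightarrow> (a + (t - a mod N)) mod N = t"
    and "t < a mod N \<Longrightarrow> (a + (N + t - a mod N)) mod N = t"
proof -
  have a: "a div N * N + a mod N = a" by simp
  show "(a + (t - a mod N)) mod N = t" if "a mod N \<le> t"
    by (rule div_mod_eqI(2)[OF assms, of _ "a div N"]) (use a that in linarith)
  have lt: "a mod N < N" using N_pos by simp
  show "(a + (N + t - a mod N)) mod N = t" if "t < a mod N"
  proof (rule div_mod_eqI(2)[OF assms, of _ "a div N + 1"])
    have "(a div N + 1) * N = a div N * N + N" by simp
    then show "a + (N + t - a mod N) = (a div N + 1) * N + t" using a lt by linarith
  qed
qed

lemma col_in_row:
  assumes "t < N"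
  obtains k where "k < N" "(a + k) mod N = t"
proof (cases "a mod N \<le> t")
  case True
  then show thesis using that[of "t - a mod N"] col_hit(1)[OF assms] assms by simp
next
  case False
  moreover have "a mod N < N" using N_pos by simp
  ultimately show thesis using that[of "N + t - a mod N"] col_hit(2)[OF assms, of a] by simp
qed

text \<open>The untouched fixed letters 0, \<open>2 * J - 1\<close> and \<open>m + 6\<close> stand
  in columns 1, \<open>4 * J - 1\<close> and \<open>2 * m + 13\<close>, which cut the cyclic row
  into gaps of at most \<open>l + 2\<close>.\<close>

lemma untouched_Fixed_in_window:
  obtains k f where "k \<le> l + 1" "bas (a + k) = Fixed f" "\<not> touched (Fixed f)"
proof -
  have u: "\<not> touched (Fixed 0)" "\<not> touched (Fixed (2 * J - 1))" "\<not> touched (Fixed (m + 6))"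
    unfolding touched_Fixed using fx_range fx_avoids by fastforce+
  have N: "2 * (m + 6) + 1 < N" "1 < N" "2 * (2 * J - 1) + 1 < N" using params J_bounds by simp_all
  let ?c = "a mod N"
  consider "?c \<le> 1" | "1 < ?c" "?c \<le> 2 * (2 * J - 1) + 1" | "2 * (2 * J - 1) + 1 < ?c" "?c \<le> 2 * (m + 6) + 1"
    | "2 * (m + 6) + 1 < ?c" by linarith
  then show thesis
  proof cases
    case 1
    then show thesis
      using that[of "1 - ?c" 0] u col_hit(1)[OF N(2) 1] by (simp add: bas_eq_Fixed)
  next
    case 2
    have "2 * (2 * J - 1) + 1 - ?c \<le> l + 1" using 2 J_bounds by linarith
    then show thesis
      using that u(2) col_hit(1)[OF N(3) 2(2)] unfolding bas_eq_Fixed by blast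
  next
    case 3
    have "2 * (m + 6) + 1 - ?c \<le> l + 1" 
    proof -
      have "4 * J \<le> ?c" using 3(1) J_bounds(3) by simp
      then have "2 * (m + 6) + 1 - ?c \<le> 2 * (m + 6) + 1 - 4 * J" by (rule diff_le_mono2)
      also have "\<dots> \<le> l + 1" 
        using m_cases
      proof (elim disjE conjE)
        assume "m = 2 * J" then show ?thesis using params(1) by simp
      next
        assume ml: "m = 2 * J + 1" "l = 4 * J + 3"
        then have "2 * (m + 6) + 1 - 4 * J = 15" by simp
        moreover have "15 \<le> l + 1" using J_bounds(3) unfolding ml(2) by linarith
        ultimately show ?thesis by (simp only:)
      qed
      finally show ?thesis .
    qed
    then show thesis
      using that u(3) col_hit(1)[OF N(1) 3(2)] unfolding bas_eq_Fixed by blast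
  next
    case 4
    have "N + (2 * 0 + 1) - ?c \<le> N - (2 * m + 13)" using 4 by simp
    also have "\<dots> \<le> l + 1" using m_cases J_bounds(1,2) params(1,3) by auto
    finally have "N + (2 * 0 + 1) - ?c \<le> l + 1" .
    moreover have "(a + (N + (2 * 0 + 1) - ?c)) mod N = 2 * 0 + 1"
      by (rule col_hit(2)) (use N 4 in simp_all)
    ultimately show thesis
      using that u(1) unfolding bas_eq_Fixed by blast
  qed
qed

text \<open>Moving letters follow each other in cyclic order, at most two positions apart. From each
  of them at most \<open>l / 2\<close> steps lead to 0, 7 or a letter from \<open>2 * J + 6\<close>
  on, all untouched; one more position is lost if the window starts on a fixed letter.\<close>

lemma untouched_Moving_in_window:
  obtains k u where "k \<le> l + 1" "bas (a + k) = Moving u" "\<not> touched (Moving u)"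
proof -
  obtain d where d: "d \<le> 1" "even ((a + d) mod N)"
  proof (cases "even (a mod N)")
    case True
    then show thesis using that[of 0] by simp
  next
    case False
    then show thesis using that[of 1] unfolding mod_N_Suc by simp
  qed
  define v where "v = (a + d) div N * l + (a + d) mod N div 2"
  have hit: thesis if h: "2 * h \<le> l" and u: "(v + h) mod (l + 1) = u" "\<not> touched (Moving u)" for h u
  proof -
    obtain j' where j': "a + d \<le> j'" "j' \<le> a + d + 2 * h" "bas j' = Moving u"
      using Moving_iter[OF d(2), of h] u(1) unfolding v_def by blast
    then have "j' - a \<le> l + 1" "a + (j' - a) = j'" using h d(1) by simp_all
    with j'(3) u(2) show thesis using \<open>\<And>k u. \<lbrakk>k \<le> l + 1; bas (a + k) = Moving u; \<not> touched (Moving u)\<rbrakk> \<Longrightarrow> thesis\<close> by metis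
  qed
  have unt: "\<not> touched (Moving u)" if "u = 0 \<or> u = 7 \<or> 2 * J + 6 \<le> u" for u
  proof
    assume "touched (Moving u)"
    then obtain i where "i < J + 2" "u = mv i \<or> u = mv i + 1" unfolding touched_Moving by blast
    then show False using mv_range[of i] mv_avoids[of i] that by auto
  qed
  let ?u = "v mod (l + 1)"
  have add: "(v + h) mod (l + 1) = ?u + h" if "?u + h \<le> l" for h
    using that by (metis mod_add_left_eq mod_less less_Suc_eq_le Suc_eq_plus1)
  consider "?u = 0 \<or> 2 * J + 6 \<le> ?u" | "1 \<le> ?u" "?u \<le> 7" | "8 \<le> ?u" "?u < 2 * J + 6" by linarith
  then show thesis
  proof cases
    case 1
    then show thesis using hit[of 0 ?u] unt[of ?u] by auto
  next
    case 2
    have "(v + (7 - ?u)) mod (l + 1) = 7" using add[of "7 - ?u"] 2 params(1) by simp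
    moreover have "2 * (7 - ?u) \<le> l" using 2 params(1) by linarith
    ultimately show thesis using hit unt by blast
  next
    case 3
    have "(v + (2 * J + 6 - ?u)) mod (l + 1) = 2 * J + 6" using add[of "2 * J + 6 - ?u"] 3 params(10) by simp
    moreover have "2 * (2 * J + 6 - ?u) \<le> l" using 3 J_bounds by linarith
    ultimately show thesis using hit unt by blast
  qed
qed

lemma long_run_dvd:
  assumes e: "\<And>k. k \<le> l + 1 \<Longrightarrow> w (a + k) = w (a + p + k)"
  shows "B dvd p"
proof -
  obtain k f where k: "k \<le> l + 1" "bas (a + k) = Fixed f" "\<not> touched (Fixed f)"
    by (rule untouched_Fixed_in_window)
  then have "bas (a + p + k) = Fixed f" using untouched_eq[OF e[OF k(1)]] by simp
  with k(2) have "(a + p + k) mod N = (a + k) mod N" unfolding bas_eq_Fixed by simp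
  then have "N dvd (a + p + k) - (a + k)" by (subst mod_eq_dvd_iff_nat[symmetric]) simp_all
  then obtain t where t: "p = t * N" unfolding dvd_def by (auto simp: mult.commute[of N])
  obtain k u where k: "k \<le> l + 1" "bas (a + k) = Moving u" "\<not> touched (Moving u)"
    by (rule untouched_Moving_in_window)
  then have b: "bas (a + p + k) = Moving u" using untouched_eq[OF e[OF k(1)]] by simp
  define z where "z = a + k"
  define v where "v = z div N * l + z mod N div 2"
  have "a + p + k = z + t * N" unfolding z_def t by simp
  then have "(a + p + k) mod N = z mod N" "(a + p + k) div N = z div N + t"
    using N_pos by simp_all
  moreover have "(z div N + t) * l + z mod N div 2 = v + t * l" unfolding v_def by (simp add: distrib_right)
  ultimately have "(v + t * l) mod (l + 1) = u" using b unfolding bas_eq_Moving by simp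
  moreover have "v mod (l + 1) = u" using k(2) unfolding bas_eq_Moving v_def z_def by simp
  ultimately have "(l + 1) dvd t * l" by (metis mod_eq_dvd_iff_nat le_add1 add_diff_cancel_left')
  then have "(l + 1) dvd t" by (rule dvd_mult_l)
  then show ?thesis unfolding B_def t by (subst mult.commute) (rule mult_dvd_mono[OF _ dvd_refl])
qed

lemma bas_add_B: "bas (x + q * B) = bas x"
proof -
  have "x + q * B = x + (q * (l + 1)) * N" unfolding B_def by (simp only: mult.assoc mult.commute mult.left_commute)
  then have "(x + q * B) mod N = x mod N" "(x + q * B) div N = x div N + q * (l + 1)"
    using N_pos by simp_all
  moreover have "(x div N + q * (l + 1)) * l + c = (x div N * l + c) + (q * l) * (l + 1)" for c
    by (simp add: algebra_simps)
  then have "((x div N + q * (l + 1)) * l + c) mod (l + 1) = (x div N * l + c) mod (l + 1)" for c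
    by (simp only: mod_mult_self1)
  ultimately show ?thesis unfolding bas_def by presburger
qed

section \<open>Multiples of \<open>B\<close> as periods\<close>

lemma site_sum:
  assumes e: "w x = w (x + q * B)" and i: "i < J + 2" "d < 4" "bas x = sl i d"
  shows "4 dvd (\<Sum>j\<in>{K i x + 1..K i x + q}. eps i j)"
proof -
  have "w (x + q * B) = sl i ((d + X i (K i x + q)) mod 4)"
    using w_site[OF i(1,2), of "x + q * B"] i(3) bas_add_B K_add_B[OF i(1)] by simp
  moreover have "w x = sl i ((d + X i (K i x)) mod 4)" by (rule w_site[OF i])
  ultimately have "(d + X i (K i x + q)) mod 4 = (d + X i (K i x)) mod 4"
    using e sl_inj[OF i(1,1)] by simp
  then have "4 dvd (d + X i (K i x + q)) - (d + X i (K i x))"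
    unfolding X_add by (subst mod_eq_dvd_iff_nat[symmetric]) simp_all
  then show ?thesis unfolding X_add by simp
qed

lemma site_cols:
  "bas x = sl i 0 \<longleftrightarrow> x mod N = 2 * fx i + 1" "bas x = sl i 3 \<longleftrightarrow> x mod N = 2 * fx i + 3"
  unfolding sl_simps bas_eq_Fixed by (rule refl) (simp add: eval_nat_numeral)

lemma fx_small: "fx (Suc 0) = m + 2" "fx 2 = m" "fx 3 = 1"
  unfolding fx_def by simp_all

text \<open>Over one base period a site that is seen must pause. Site 3 never does, so its columns 3
  and 5 are avoided, and the window then contains the columns \<open>2 * m + 3\<close> of site 2 and
  \<open>2 * m + 5\<close> of site 1. Site 2 pauses only at numbers 3 modulo 4 and site 1 only at
  numbers 1 modulo 4, but their counters there differ by at most 1.\<close>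

lemma period_B_no_run:
  assumes e: "\<And>k. k \<le> l + 1 \<Longrightarrow> w (a + k) = w (a + k + B)"
  shows False
proof -
  have zero: "eps i (K i (a + k) + 1) = 0" if "i < J + 2" "d < 4" "bas (a + k) = sl i d" "k \<le> l + 1" for i d k
  proof -
    have "4 dvd eps i (K i (a + k) + 1)"
      using site_sum[of "a + k" 1 i d] e[OF that(4)] that by simp
    then show ?thesis using eps_le[of i "K i (a + k) + 1"] by (auto dest: dvd_imp_le)
  qed
  have site3: False if "(a + k) mod N = 3 \<or> (a + k) mod N = 5" "k \<le> l + 1" for k
  proof -
    have "bas (a + k) = sl 3 0 \<or> bas (a + k) = sl 3 3"
      unfolding site_cols fx_small using that(1) by auto
    moreover have "3 < J + 2" "(0::nat) < 4" "(3::nat) < 4" using J_bounds(3) by simp_all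
    ultimately have "eps 3 (K 3 (a + k) + 1) = 0" using zero that(2) by metis
    then show False by (simp add: eps_def)
  qed
  have N: "5 < N" "3 < N" "2 * m + 5 < N" using params by simp_all
  let ?c = "a mod N"
  consider "?c \<le> 5" | "2 * m + 3 < ?c" | "6 \<le> ?c" "?c \<le> 2 * m + 3" by linarith
  then show False
  proof cases
    case 1
    have "5 - ?c \<le> l + 1" using params(1) by simp
    then show False using site3 col_hit(1)[OF N(1) 1] by blast
  next
    case 2
    have "N + 3 - ?c \<le> N - (2 * m + 1)" using 2 by simp
    also have "\<dots> \<le> l + 1" using m_cases params(3) by auto
    finally have "N + 3 - ?c \<le> l + 1" .
    moreover have "(a + (N + 3 - ?c)) mod N = 3" using 2 by (intro col_hit(2)[OF N(2)]) simp
    ultimately show False using site3 by blast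
  next
    case 3
    define k where "k = 2 * m + 3 - ?c"
    have "k + 2 \<le> 2 * m - 1" unfolding k_def using 3 by simp
    also have "\<dots> \<le> l + 1" using m_cases J_bounds(1) by auto
    finally have kl: "k + 2 \<le> l + 1" .
    have "2 * m + 3 < N" using N(3) by simp
    from col_hit(1)[OF this 3(2)] have c1: "(a + k) mod N = 2 * m + 3" unfolding k_def .
    have "2 * m + 3 + 2 < N" using N(3) by simp
    then have c2: "(a + (k + 2)) mod N = 2 * (m + 2) + 1" using no_wrap(1)[of "a + k" 2] c1 by (simp add: add.assoc)
    define x where "x = a + k"
    have "eps 2 (K 2 x + 1) = 0" unfolding x_def
      by (rule zero[of 2 3]) (use c1 kl J_bounds(3) in \<open>simp_all add: site_cols fx_small del: sl_simps\<close>)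
    then have k2: "(K 2 x + 1) mod 4 = 3" by (simp add: eps_def split: if_splits)
    have "eps 1 (K 1 (a + (k + 2)) + 1) = 0"
      by (rule zero[of 1 0]) (use c2 kl J_bounds(3) in \<open>simp_all add: site_cols fx_small del: sl_simps\<close>)
    then have "eps 1 (K 1 (x + 2) + 1) = 0" by (simp only: x_def add.assoc)
    then have k1: "(K 1 (x + 2) + 1) mod 4 = 1" by (simp add: eps_def split: if_splits)
    have m6: "6 \<le> m" "m < l" using params(9,5,11) J_bounds(3) by simp_all
    have "fx 1 + (l + 2) - mv 1 = m + (l + 1)" "fx 2 + (l + 2) - mv 2 = (m - 4) + (l + 1)"
      using m6 by (simp_all add: fx_def mv_def)
    then have "(fx 1 + (l + 2) - mv 1) mod (l + 1) = m" "(fx 2 + (l + 2) - mv 2) mod (l + 1) = m - 4"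
      using m6 by (simp_all only: mod_add_self2) simp_all
    then have e12: "ev 1 = m * N + (2 * m + 5)" "ev 2 = (m - 4) * N + (2 * m + 1)"
      unfolding ev_def by (simp_all add: fx_small)
    have "m = (m - 4) + 4" using m6 by simp
    then have "m * N = (m - 4) * N + 4 * N" by (metis distrib_right)
    then have e1: "ev 1 = ev 2 + 4 * N + 4" using e12 by simp
    have eB: "ev 1 < B" by (rule ev_less) simp
    have "5 * N \<le> B" unfolding B_def using params(1) by simp
    then have B: "4 * N + 2 \<le> B" using N by simp
    have "K 1 (x + 2) \<le> K 2 x" unfolding K_def using e1 eB by (intro div_le_mono) simp
    moreover have "K 2 x \<le> (x + 2 + B - ev 1 + B) div B"
      unfolding K_def using e1 eB B by (intro div_le_mono) simp
    then have "K 2 x \<le> K 1 (x + 2) + 1" unfolding K_def using B_pos by simp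
    ultimately have "K 2 x = K 1 (x + 2) \<or> K 2 x = K 1 (x + 2) + 1" by linarith
    moreover have "(K 1 (x + 2) + 1 + 1) mod 4 = 2" using k1 by (subst mod_add_left_eq[symmetric]) simp
    ultimately show False using k1 k2 by auto
  qed
qed

text \<open>Site 3 rotates \<open>q\<close> times, so 4 divides \<open>q\<close>. Site 2 rotates
  three times in four, so for \<open>q = 4 * q'\<close> also \<open>q'\<close> is a multiple of 4.
  For \<open>q = 4 ^ i * s\<close> site \<open>i + 2\<close> rotates \<open>s\<close> times, which
  gains one more factor 4; site \<open>J + 1\<close> ends this at \<open>4 ^ J\<close>.\<close>

lemma q_divisible:
  assumes e: "\<And>k. k \<le> q * (l + 1) \<Longrightarrow> w (a + k) = w (a + k + q * B)" and q: "2 \<le> q"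
  shows "4 ^ J dvd q"
proof -
  \<comment> \<open>For \<open>2 \<le> q\<close> the run covers a whole row, so it sees the first
    fixed letter of every site.\<close>
  have dvd: "\<exists>k. 4 dvd (\<Sum>j\<in>{k + 1..k + q}. eps i j)" if i: "i < J + 2" for i
  proof -
    have "2 * fx i + 1 < N" using fx_range[OF i] params by simp
    from col_in_row[OF this, of a] obtain k where k: "k < N" "(a + k) mod N = 2 * fx i + 1" by blast
    have "2 * (l + 1) \<le> q * (l + 1)" using q by (rule mult_le_mono1)
    moreover have "k \<le> 2 * (l + 1)" using k(1) params(3) by simp
    ultimately have "k \<le> q * (l + 1)" by (rule order.trans[rotated])
    then have "4 dvd (\<Sum>j\<in>{K i (a + k) + 1..K i (a + k) + q}. eps i j)"
      using site_sum[of "a + k" q i 0] e i k(2) by (simp add: site_cols del: sl_simps)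
    then show ?thesis by blast
  qed
  have "4 dvd q" using dvd[of 3] J_bounds(3) by (simp add: eps_def)
  then obtain q' where q': "q = 4 * q'" by blast
  obtain k where k: "4 dvd (\<Sum>j\<in>{k + 1..k + q}. eps 2 j)" using dvd[of 2] J_bounds(3) by auto
  have "{1..4::nat} = {1, 2, 3, 4}" by auto
  then have "(\<Sum>j\<in>{1..4}. eps 2 j) = 3" by (simp add: eps_def)
  moreover have "(\<Sum>j\<in>{k + 1..k + 4 * q'}. eps 2 j) = q' * (\<Sum>j\<in>{1..4}. eps 2 j)"
    by (rule sum_periodic) (simp add: eps_def)
  ultimately have "4 dvd q' * 3" using k q' by simp
  then have "4 dvd q'" by presburger
  then have 16: "4 ^ 2 dvd q" unfolding q' by auto
  have "i \<le> J \<Longrightarrow> 4 ^ i dvd q" if "2 \<le> i" for i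
    using that
  proof (induction i rule: dec_induct)
    case base
    show ?case by (rule 16)
  next
    case (step i)
    then obtain s where s: "q = 4 ^ i * s" by fastforce
    obtain k where k: "4 dvd (\<Sum>j\<in>{k + 1..k + q}. eps (i + 2) j)" using dvd[of "i + 2"] step by auto
    have "2 \<le> i" using step by simp
    then have "i + 2 \<noteq> 0" "i + 2 \<noteq> 1" "i + 2 \<noteq> 2" "i + 2 \<noteq> 3" "i + 2 - 2 = i" by linarith+
    then have eps: "eps (i + 2) j = of_bool (4 ^ i dvd j)" for j unfolding eps_def by (simp only: if_False)
    have "(\<Sum>j\<in>{k + 1..k + 4 ^ i * s}. eps (i + 2) j) = s * (\<Sum>j\<in>{1..4 ^ i}. eps (i + 2) j)"
      by (rule sum_periodic) (simp only: eps dvd_add_triv_right_iff)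
    also have "(\<Sum>j\<in>{1..4 ^ i}. eps (i + 2) j) = 1" unfolding eps by (rule sum_of_bool_dvd) simp
    finally have "4 dvd s" using k s by simp
    then show ?case unfolding s by auto
  qed
  then show ?thesis using J_bounds(3) by simp
qed

text \<open>Makes a run of period \<open>q * B\<close> with \<open>q = 4 ^ J * s\<close> long enough
  for \<open>2 * s\<close> base periods and a further row, the window that
  \<open>oddpart_shift_parity\<close> demands.\<close>

lemma pow4_bound: "2 * N + 2 \<le> 4 ^ J"
proof -
  have *: "16 * j + 16 \<le> 4 ^ j" if "3 \<le> j" for j :: nat
    using that by (induction j rule: dec_induct) simp_all
  have "J = 3 \<or> 4 \<le> J" using J_bounds(3) by auto
  then show ?thesis
  proof
    assume "J = 3"
    then show ?thesis using J_bounds(2) params(3) by simp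
  next
    assume "4 \<le> J"
    then show ?thesis using *[of J] J_bounds(2) params(3) by linarith
  qed
qed

lemma period_qB_no_run:
  assumes e: "\<And>k. k \<le> q * (l + 1) \<Longrightarrow> w (a + k) = w (a + k + q * B)" and q: "2 \<le> q"
  shows False
proof -
  obtain s where s: "q = 4 ^ J * s" using q_divisible[OF e q] by blast
  have s0: "0 < s" using q s by (cases s) simp_all
  have f: "2 * fx 0 + 1 < N" using fx_range[of 0] params by simp
  obtain k0 where k0: "k0 < N" "(a + k0) mod N = 2 * fx 0 + 1" using col_in_row[OF f, of a] by blast
  define k where "k = K 0 (a + k0)"
  \<comment> \<open>The positions \<open>a + k0 + h * B\<close> lie in the run and carry slot 0 of
    site 0 with counter \<open>k + h\<close>.\<close>
  have X: "X 0 (k + h + q) mod 4 = X 0 (k + h) mod 4" if h: "h \<le> 2 * s" for h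
  proof -
    have "h * N \<le> 2 * s * N" using h by (rule mult_le_mono1)
    moreover have "2 * s * N + 2 \<le> q"
    proof -
      have "2 * s * N + 2 \<le> s * (2 * N + 2)" using s0 by (simp add: algebra_simps)
      also have "\<dots> \<le> s * 4 ^ J" using pow4_bound by (rule mult_le_mono2)
      finally show ?thesis by (simp add: s mult.commute)
    qed
    ultimately have "(h * N + 2) * (l + 1) \<le> q * (l + 1)" by (intro mult_le_mono1) linarith
    then have "h * B + 2 * (l + 1) \<le> q * (l + 1)" unfolding B_def by (simp only: add_mult_distrib mult.assoc)
    moreover have "k0 + h * B \<le> h * B + 2 * (l + 1)" using k0(1) params(3) by simp
    ultimately have "k0 + h * B \<le> q * (l + 1)" by (rule order.trans[rotated])
    from e[OF this] have ee: "w (a + k0 + h * B) = w (a + k0 + h * B + q * B)" by (simp only: add.assoc)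
    have "bas (a + k0 + h * B) = sl 0 0" using k0(2) unfolding bas_add_B site_cols .
    from site_sum[OF ee _ _ this] have "4 dvd (\<Sum>j\<in>{K 0 (a + k0 + h * B) + 1..K 0 (a + k0 + h * B) + q}. eps 0 j)"
      by simp
    moreover have "K 0 (a + k0 + h * B) = k + h" unfolding k_def by (rule K_add_B) simp
    ultimately have "4 dvd (\<Sum>j\<in>{k + h + 1..k + h + q}. eps 0 j)" by (simp only:)
    then show ?thesis unfolding X_add by (auto elim!: dvdE)
  qed
  \<comment> \<open>Subtracting the congruences for successive \<open>h\<close> isolates one
    schedule value; being 0 or 1, it is determined by its residue modulo 4.\<close>
  have "eps 0 (j + q) = eps 0 j" if "j \<in> {k + 1..k + 2 * s}" for j
  proof -
    define h where "h = j - k - 1"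
    have j: "j = Suc (k + h)" "h + 1 \<le> 2 * s" using that unfolding h_def by auto
    have "X 0 (k + h + q) mod 4 = X 0 (k + h) mod 4" "X 0 (Suc (k + h + q)) mod 4 = X 0 (Suc (k + h)) mod 4"
      using X[of h] X[of "h + 1"] j(2) by simp_all
    then have "(X 0 (k + h) + eps 0 (Suc (k + h + q))) mod 4 = (X 0 (k + h) + eps 0 (Suc (k + h))) mod 4"
      unfolding X_Suc by (metis mod_add_left_eq)
    then have "eps 0 (Suc (k + h + q)) mod 4 = eps 0 (Suc (k + h)) mod 4"
      by (metis add.commute add_mod4_cancel)
    moreover have "eps 0 i < 4" for i using eps_le[of 0 i] by simp
    ultimately show ?thesis unfolding j by simp
  qed
  then have "oddpart (j + 4 ^ J * s) div 4 ^ J mod 2 = oddpart j div 4 ^ J mod 2" if "j \<in> {k + 1..k + 2 * s}" for j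
    using that unfolding eps_def s by simp
  moreover have "1 \<le> J" using J_bounds(3) by simp
  ultimately show False using oddpart_shift_parity[of J s k] s0 by blast
qed

text \<open>A factor with period \<open>p\<close> and exponent above
  \<open>n / (n - 1) = 1 + 1 / N\<close> would give \<open>p div N + 1\<close> equalities at
  distance \<open>p\<close>. That is at least 2 of them from \<open>N\<close> on, 3 from
  \<open>2 * N\<close> on and \<open>l + 2\<close> from \<open>B\<close> on, as the preceding lemmas
  require.\<close>

lemma no_short_repetition:
  assumes "0 < p"
  shows "\<exists>i\<le>p div N. w (a + i) \<noteq> w (a + p + i)"
proof (rule ccontr)
  assume "\<not> ?thesis"
  then have e: "w (a + i) = w (a + p + i)" if "i \<le> p div N" for i using that by blast
  have e0: "w a = w (a + p)" using e[of 0] by simp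
  then have Np: "N \<le> p" using near_ge[of a "a + p"] assms by simp
  consider "p < 2 * N" | "2 * N \<le> p" "p < B" | "B \<le> p" by linarith
  then show False
  proof cases
    case 1
    have "1 \<le> p div N" using Np N_pos by (simp add: Suc_le_eq div_greater_zero_iff)
    then show False using near_no_run[OF e0] e[of 1] 1 assms by simp
  next
    case 2
    have "2 * N div N \<le> p div N" using 2(1) by (rule div_le_mono)
    then have "2 \<le> p div N" using N_pos by simp
    then show False using mid_no_run[of a "a + p"] e 2 by simp
  next
    case 3
    have "B div N \<le> p div N" using 3 by (rule div_le_mono)
    then have "l + 1 \<le> p div N" using N_pos by (simp add: B_def)
    then have "B dvd p" using long_run_dvd[of a p] e by simp
    then obtain q where q: "p = q * B" by (auto simp: dvd_def mult.commute)
    have "q * B = q * (l + 1) * N" unfolding B_def by (simp only: mult.assoc mult.commute mult.left_commute)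
    then have pN: "p div N = q * (l + 1)" unfolding q using N_pos by simp
    have e': "w (a + k) = w (a + k + q * B)" if "k \<le> q * (l + 1)" for k
    proof -
      have "a + p + k = a + k + q * B" unfolding q by (simp only: add.assoc add.commute add.left_commute)
      then show ?thesis using e[of k] that unfolding pN by (simp only:)
    qed
    have "q \<noteq> 0" using assms q by (intro notI) simp
    then have "q = 1 \<or> 2 \<le> q" by auto
    then show False using period_B_no_run[of a] period_qB_no_run[of q a] e' by auto
  qed
qed

section \<open>Coding over the alphabet and the exponents of factors\<close>

definition code :: "letter \<Rightarrow> nat" where
  "code a = (case a of Fixed f \<Rightarrow> f + 1 | Moving u \<Rightarrow> phi + u + 1)"

definition W :: "nat \<Rightarrow> nat" where
  "W j = code (w j)"

definition letters :: "letter set" where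
  "letters = Fixed ` {..<phi} \<union> Moving ` {..l}"

lemma code_inj: "inj_on code letters"
  unfolding inj_on_def letters_def code_def by auto

lemma code_in_alphabet: "a \<in> letters \<Longrightarrow> code a \<in> alphabet n"
  unfolding letters_def code_def alphabet_def using params(12) by auto

lemma w_in_letters: "w j \<in> letters"
proof -
  have sl: "sl i d \<in> letters" if "i < J + 2" for i d
    unfolding sl_def letters_def using fx_range[OF that] mv_range[OF that] by auto
  show ?thesis
  proof (cases "touched (bas j)")
    case True
    then show ?thesis using w_site sl unfolding touched_def by metis
  next
    case False
    have "j mod N < N" using N_pos by simp
    then have "odd (j mod N) \<Longrightarrow> j mod N div 2 < phi" using params(7,8) by (elim oddE) simp
    then have "bas j \<in> letters"
      unfolding bas_def letters_def by (auto simp: less_Suc_eq_le[symmetric])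
    then show ?thesis using False by (simp add: w_untouched)
  qed
qed

lemma W_in_alphabet: "W j \<in> alphabet n"
  unfolding W_def by (intro code_in_alphabet w_in_letters)

lemma W_eq_iff: "W x = W y \<longleftrightarrow> w x = w y"
  unfolding W_def using code_inj w_in_letters by (auto dest: inj_onD)

lemma exponent_W_le: "exponent (map W [a..<b]) \<le> real n / real (n - 1)"
proof (rule ccontr)
  let ?u = "map W [a..<b]"
  assume "\<not> ?thesis"
  moreover obtain p where p: "is_period ?u p" "exponent ?u = real (length ?u) / real p"
    using exponent_is_greatest(1)[of ?u] unfolding is_exponent_def by blast
  ultimately have "real n / real N < real (b - a) / real p" by (simp add: N_def)
  moreover have p0: "0 < p" using p(1) by (simp add: is_period_def)
  ultimately have "real n * real p < real (b - a) * real N" using N_pos by (simp add: field_simps)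
  then have "n * p < (b - a) * N" by (metis of_nat_less_iff of_nat_mult)
  moreover have "n * p = p + N * p" using arg_cong[OF n_eq, of "\<lambda>z. z * p"] by simp
  ultimately have lt: "p + N * p < (b - a) * N" by (simp only:)
  have "p div N * N \<le> p" by simp
  moreover have "(p div N + p) * N = p div N * N + N * p" by (simp only: distrib_right mult.commute[of p N])
  ultimately have "(p div N + p) * N < (b - a) * N" using lt by linarith
  then have len: "p div N + p < b - a" by simp
  obtain i where i: "i \<le> p div N" "w (a + i) \<noteq> w (a + p + i)" using no_short_repetition[OF p0] by blast
  have "?u ! (i + p) = ?u ! i" using p(1) i(1) len unfolding is_period_def by simp
  then have "W (a + (i + p)) = W (a + i)" using i(1) len by simp
  then have "w (a + (i + p)) = w (a + i)" unfolding W_eq_iff .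
  then show False using i(2) by (simp add: add.commute add.left_commute)
qed

end

section \<open>Distinct words from the free bits\<close>

text \<open>The position is place number \<open>4 * t + 1\<close> of site 1, where its schedule
  reads bit \<open>t\<close>. Earlier rotations agree, so the two rotation counts differ by exactly
  one, which is visible modulo 4.\<close>

lemma (in dejean_word) w_distinct:
  assumes n: "dejean_word n" and lt: "\<And>s. s < t \<Longrightarrow> bit s = bit' s" and ne: "bit t \<noteq> bit' t"
  shows "w (ev 1 + 4 * t * B) \<noteq> dejean_word.w n bit' (ev 1 + 4 * t * B)"
proof
  interpret other: dejean_word n bit' by (rule n)
  let ?g = "ev 1 + 4 * t * B"
  assume eq: "w ?g = other.w ?g"
  have J: "1 < J + 2" by simp
  have g: "?g mod B = ev 1" using ev_less[OF J] by simp
  have K: "K 1 ?g = Suc (4 * t)" using K_add_B[OF J, of "ev 1" "4 * t"] B_pos by (simp add: K_def)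
  have b: "bas ?g = sl 1 0" by (rule event_block(2)[OF J g])
  have "eps 1 k = other.eps 1 k" if "k \<in> {1..4 * t}" for k
  proof -
    have "k \<le> 4 * t" using that by simp
    then have "k mod 4 = 1 \<Longrightarrow> k div 4 < t" using div_mult_mod_eq[of k 4] by linarith
    then show ?thesis unfolding eps_def other.eps_def using lt by simp
  qed
  then have X: "X 1 (4 * t) = other.X 1 (4 * t)" unfolding X_def other.X_def by (intro sum.cong) simp_all
  have d: "Suc (4 * t) mod 4 = 1" "Suc (4 * t) div 4 = t" by presburger+
  have "eps 1 (Suc (4 * t)) = of_bool (bit t)" "other.eps 1 (Suc (4 * t)) = of_bool (bit' t)"
    unfolding eps_def other.eps_def d by simp_all
  moreover have "(X 1 (Suc (4 * t))) mod 4 = (other.X 1 (Suc (4 * t))) mod 4"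
    using eq w_site[OF J _ b] other.w_site[OF J _ b] sl_inj[OF J J] unfolding K by simp
  ultimately have "(of_bool (bit t) + X 1 (4 * t)) mod 4 = (of_bool (bit' t) + X 1 (4 * t)) mod (4::nat)"
    unfolding X_Suc other.X_Suc X by (simp add: add.commute)
  then have "of_bool (bit t) mod 4 = (of_bool (bit' t) mod 4 :: nat)" by (rule add_mod4_cancel)
  then show False using ne by (auto simp: of_bool_def split: if_splits)
qed

section \<open>The lower bound for the repetition threshold\<close>

text \<open>For smaller \<open>r\<close> any \<open>n\<close> consecutive letters would be distinct,
  since a letter repeated at distance \<open>d < n\<close> gives exponent \<open>1 + 1 / d\<close>.
  Then the whole alphabet occurs in every such window, the word has period \<open>n\<close>, and its
  squares have exponent 2.\<close>

lemma RT_lower_bound: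
  fixes x :: "nat \<Rightarrow> nat"
  assumes n: "2 \<le> n" and x: "range x \<subseteq> alphabet n" "plus_free_inf r x"
  shows "real n / real (n - 1) \<le> r"
proof (rule ccontr)
  assume r: "\<not> ?thesis"
  have exp: "real (b - a) / real p \<le> r" if "is_period (map x [a..<b]) p" for a b p
  proof -
    have "is_exponent (map x [a..<b]) (real (b - a) / real p)"
      unfolding is_exponent_def using that by auto
    then have "real (b - a) / real p \<le> exponent (map x [a..<b])" by (rule exponent_is_greatest(2))
    also have "\<dots> \<le> r" using x(2) unfolding plus_free_inf_def by blast
    finally show ?thesis .
  qed
  have ne: "x i \<noteq> x j" if ij: "i < j" "j < i + n" for i j
  proof
    assume eq: "x i = x j"
    have "is_period (map x [i..<j + 1]) (j - i)"
      unfolding is_period_def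
    proof (intro conjI allI impI)
      show "0 < j - i" using ij by simp
      fix k assume "k + (j - i) < length (map x [i..<j + 1])"
      then have "k = 0" using ij by simp
      then show "map x [i..<j + 1] ! (k + (j - i)) = map x [i..<j + 1] ! k"
        using ij eq by (simp del: upt_Suc)
    qed
    from exp[OF this] have "real (j + 1 - i) / real (j - i) \<le> r" .
    moreover have "real (j + 1 - i) / real (j - i) = 1 + 1 / real (j - i)"
      using ij by (simp add: field_simps of_nat_diff)
    moreover have "1 / real (n - 1) \<le> 1 / real (j - i)" using ij by (intro divide_left_mono) auto
    moreover have "real n / real (n - 1) = 1 + 1 / real (n - 1)" using n by (simp add: field_simps of_nat_diff)
    ultimately show False using r by linarith
  qed
  have per: "x (i + n) = x i" for i
  proof -
    have inj: "inj_on x {i..<i + n}"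
    proof (rule inj_onI)
      fix a b assume "a \<in> {i..<i + n}" "b \<in> {i..<i + n}" "x a = x b"
      then show "a = b" using ne[of a b] ne[of b a] by (cases a b rule: linorder_cases) auto
    qed
    have "x ` {i..<i + n} = alphabet n"
    proof (rule card_subset_eq)
      show "finite (alphabet n)" "x ` {i..<i + n} \<subseteq> alphabet n" using x(1) by (auto simp: alphabet_def)
      show "card (x ` {i..<i + n}) = card (alphabet n)" by (simp add: card_image[OF inj] alphabet_def)
    qed
    moreover have "x (i + n) \<in> alphabet n" using x(1) by blast
    ultimately obtain k where k: "k \<in> {i..<i + n}" "x (i + n) = x k" by (metis imageE)
    then have "k = i" using ne[of k "i + n"] by (cases "k = i") auto
    then show ?thesis using k by simp
  qed
  have "is_period (map x [0..<2 * n]) n" unfolding is_period_def using n per by auto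
  from exp[OF this] have "2 \<le> r" using n by simp
  moreover have "real n / real (n - 1) \<le> 2" using n by (simp add: field_simps of_nat_diff)
  ultimately show False using r order.trans by blast
qed

text \<open>The constructed word makes the set under the infimum nonempty. This inequality lets the
  bound \<open>n / (n - 1)\<close> on exponents yield membership in the threshold language.\<close>

lemma RT_ge:
  assumes "27 \<le> n"
  shows "real n / real (n - 1) \<le> RT n"
  unfolding RT_def
proof (rule cInf_greatest)
  interpret dejean_word n "\<lambda>_. True" by unfold_locales (rule assms)
  have "plus_free_inf (real n / real (n - 1)) W" "range W \<subseteq> alphabet n"
    unfolding plus_free_inf_def using exponent_W_le W_in_alphabet by auto
  moreover have "1 < real n / real (n - 1)" using assms by (simp add: field_simps of_nat_diff)
  ultimately show "{r. 1 < r \<and> (\<exists>x. range x \<subseteq> alphabet n \<and> plus_free_inf r x)} \<noteq> {}" by blast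
next
  fix r assume "r \<in> {r. 1 < r \<and> (\<exists>x. range x \<subseteq> alphabet n \<and> plus_free_inf r x)}"
  then show "real n / real (n - 1) \<le> r" using RT_lower_bound[of n] assms by auto
qed

lemma (in dejean_word) prefix_in_language: "map W [0..<L] \<in> threshold_language n"
proof -
  have "exponent u \<le> RT n" if sub: "sublist u (map W [0..<L])" for u
  proof -
    obtain ps ss where ps: "map W [0..<L] = ps @ u @ ss" using sub unfolding sublist_def by blast
    define a where "a = length ps"
    define b where "b = a + length u"
    have "length (map W [0..<L]) = length (ps @ u @ ss)" using ps by (simp only:)
    then have L: "b \<le> L" unfolding b_def a_def by simp
    have "u = take (length u) (drop a (ps @ u @ ss))" unfolding a_def by simp
    also have "\<dots> = map W (take (length u) [a..<L])" unfolding ps[symmetric] by (simp add: drop_map take_map)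
    also have "\<dots> = map W [a..<b]" using L unfolding b_def by (simp add: take_upt)
    finally have "u = map W [a..<b]" .
    then have "exponent u \<le> real n / real (n - 1)" using exponent_W_le[of a b] by simp
    also have "\<dots> \<le> RT n" by (rule RT_ge[OF n_ge])
    finally show ?thesis .
  qed
  then show ?thesis unfolding threshold_language_def plus_free_def using W_in_alphabet by auto
qed

section \<open>Exponential growth\<close>

text \<open>Each subset of \<open>{..<T}\<close> prescribes the first \<open>T\<close> free bits.
  Two subsets differ first at some \<open>t < T\<close>, and the prefixes then differ at
  \<open>ev 1 + 4 * t * B\<close>, which is below \<open>4 * T * B\<close>.\<close>

lemma complexity_lower_bound:
  assumes n: "27 \<le> n" and L: "4 * T * dejean_word.B n \<le> L"
  shows "2 ^ T \<le> complexity (threshold_language n) L"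
proof -
  have loc: "dejean_word n" by unfold_locales (rule n)
  define f where "f A = map (dejean_word.W n (\<lambda>t. t \<in> A)) [0..<L]" for A
  have inj: "inj_on f (Pow {..<T})"
  proof (rule inj_onI, rule ccontr)
    fix A A' assume A: "A \<in> Pow {..<T}" "A' \<in> Pow {..<T}" "f A = f A'" "A \<noteq> A'"
    interpret dejean_word n "\<lambda>t. t \<in> A" by (rule loc)
    interpret other: dejean_word n "\<lambda>t. t \<in> A'" by (rule loc)
    define t where "t = (LEAST t. (t \<in> A) \<noteq> (t \<in> A'))"
    have ex: "\<exists>t. (t \<in> A) \<noteq> (t \<in> A')" using A(4) by blast
    have t: "(t \<in> A) \<noteq> (t \<in> A')" unfolding t_def using ex by (rule LeastI_ex)
    have lt: "(s \<in> A) = (s \<in> A')" if "s < t" for s using that not_less_Least unfolding t_def by blast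
    let ?g = "ev 1 + 4 * t * B"
    have "t < T" using t A(1,2) by auto
    then have "4 * (t + 1) * B \<le> 4 * T * B" by (intro mult_le_mono1) simp
    moreover have "ev 1 < B" by (rule ev_less) simp
    ultimately have "?g < L" using L by (simp add: algebra_simps)
    then have "W ?g = other.W ?g" using A(3) unfolding f_def by simp
    then have "w ?g = other.w ?g"
      unfolding W_def other.W_def using code_inj w_in_letters other.w_in_letters by (meson inj_onD)
    then show False using w_distinct[OF loc lt t] by simp
  qed
  have sub: "f ` Pow {..<T} \<subseteq> {u \<in> threshold_language n. length u = L}"
    unfolding f_def using dejean_word.prefix_in_language[OF loc] by auto
  have "finite {u \<in> threshold_language n. length u = L}"
    by (rule finite_subset[OF _ finite_lists_length_eq[of "alphabet n" L]])
      (auto simp: threshold_language_def alphabet_def)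
  from card_mono[OF this sub] show ?thesis
    unfolding complexity_def card_image[OF inj] by (simp add: card_Pow)
qed

lemma grows_exponentiallyI:
  assumes D: "0 < D" and le: "\<And>k. 2 ^ (k div D) \<le> complexity L k"
  shows "grows_exponentially L"
proof -
  \<comment> \<open>The factor 2 in the exponent absorbs the rounding in \<open>k div D\<close> once
    \<open>2 * D \<le> k\<close>.\<close>
  define c where "c = 2 powr (1 / (2 * real D))"
  have c: "1 < c" unfolding c_def using D by (intro gr_one_powr) simp_all
  have "ereal c \<le> ereal (root k (real (complexity L k)))" if k: "2 * D \<le> k" for k
  proof -
    have "k < D * (k div D) + D" using dividend_less_times_div[OF D] by (simp add: add.commute)
    then have "k \<le> 2 * (D * (k div D))" using k by linarith
    then have "real k \<le> 2 * (real D * real (k div D))" by (metis of_nat_le_iff of_nat_mult of_nat_numeral)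
    then have "real k / (2 * real D) \<le> real (k div D)" using D by (simp add: field_simps)
    then have "2 powr (real k / (2 * real D)) \<le> 2 powr real (k div D)" by simp
    also have "\<dots> = 2 ^ (k div D)" by (simp add: powr_realpow)
    also have "\<dots> \<le> real (complexity L k)" using le[of k] by (metis of_nat_le_iff of_nat_numeral of_nat_power)
    also have "2 powr (real k / (2 * real D)) = c ^ k" unfolding c_def by (simp add: powr_powr powr_realpow[symmetric])
    finally have "c ^ k \<le> real (complexity L k)" .
    moreover have "0 < k" using k D by simp
    ultimately have "root k (c ^ k) \<le> root k (real (complexity L k))" by (intro real_root_le_mono)
    then show ?thesis using \<open>0 < k\<close> c by (simp add: real_root_power_cancel)
  qed
  then have "\<forall>\<^sub>F k in sequentially. ereal c \<le> ereal (root k (real (complexity L k)))"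
    by (intro eventually_sequentiallyI)
  then have "ereal c \<le> liminf (\<lambda>k. ereal (root k (real (complexity L k))))" by (rule Liminf_bounded)
  also have "\<dots> \<le> growth_rate L" unfolding growth_rate_def by (rule Liminf_le_Limsup) simp
  finally have "ereal c \<le> growth_rate L" .
  moreover have "1 < ereal c" using c by simp
  ultimately show ?thesis unfolding grows_exponentially_def by (rule less_le_trans[rotated])
qed

theorem theorem2:
  fixes n :: nat
  assumes "n \<ge> 27"
  shows "grows_exponentially (threshold_language n)"
proof (rule grows_exponentiallyI)
  interpret dejean_word n "\<lambda>_. True" by unfold_locales (rule assms)
  \<comment> \<open>One free bit is read in every \<open>4 * B\<close> positions.\<close>
  show "0 < 4 * dejean_word.B n" using B_pos by simp
  fix k
  have "k div (4 * B) * (4 * B) \<le> k" by simp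
  then show "2 ^ (k div (4 * dejean_word.B n)) \<le> complexity (threshold_language n) k"
    by (intro complexity_lower_bound assms) (simp only: ac_simps)
qed

end
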